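(* Let $W_L\in\mathcal{B}(\mathcal{F}_n^2\otimes\mathcal{E})$ be the odometer map with symbol $L\in\mathcal{B}(\mathcal{E},\mathcal{F}_n^2\otimes\mathcal{E})$ satisfying $L\mathcal{E}\subseteq\mathcal{M}^\perp$, and let $\Theta\in H^\infty_{\mathcal{B}(\mathcal{E})}(\mathbb{D})$ be the associated analytic symbol. Then $$\|W_L\|=\max\{1,\|\Theta\|_\infty\}.$$
   Context: $n\ge1$ is an integer and $\mathcal{E}$ is a Hilbert space; Hilbert spaces are separable and complex; $\mathcal{B}(\mathcal{H},\mathcal{K})$ denotes the bounded linear operators from $\mathcal{H}$ to $\mathcal{K}$, and $\mathcal{B}(\mathcal{H})=\mathcal{B}(\mathcal{H},\mathcal{H})$. $F_n^+$ is the free monoid of words $\mu=\mu_1\cdots\mu_m$ in the letters $1,\dots,n$, with empty word $\emptyset$. The full Fock space $\mathcal{F}_n^2=\mathbb{C}\Omega\oplus\bigoplus_{k\ge1}(\mathbb{C}^n)^{\otimes k}$ has orthonormal basis $e_\mu=e_{\mu_1}\otimes\cdots\otimes e_{\mu_m}$, $\mu\in F_n^+$, with $e_\emptyset=\Omega$; $e_k^m:=e_k^{\otimes m}$, $e_k^0=\Omega$, and $\Omega$ acts as a unit for left tensoring. For $f\in\mathcal{F}_n^2\otimes\mathcal{E}$, $e_1^p\otimes f$ means left tensoring by $e_1^p$. $\mathcal{M}^\perp:=\overline{\mathrm{span}}\{e_1^m\otimes\xi:m\ge0,\xi\in\mathcal{E}\}$. Odometer map: for $L\in\mathcal{B}(\mathcal{E},\mathcal{F}_n^2\otimes\mathcal{E})$,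 $W_L$ is the bounded operator on $\mathcal{F}_n^2\otimes\mathcal{E}$ given by $W_L(\Omega\otimes\eta)=L\eta$; $W_L(e_n^m\otimes\eta)=e_1^m\otimes L\eta$ for $m\ge1$; and, for a nonempty word $\mu=\mu_1\cdots\mu_m$ having some letter $\ne n$, with $k$ the smallest index such that $\mu_k\neq n$, $W_L(e_\mu\otimes\eta)=e_1^{k-1}\otimes e_{\mu_k+1}\otimes e_{\mu_{k+1}}\otimes\cdots\otimes e_{\mu_m}\otimes\eta$. The analytic symbol associated with $W_L$ is $\Theta(z)=\sum_{r\ge0}z^rL_r\in H^\infty_{\mathcal{B}(\mathcal{E})}(\mathbb{D})$ (bounded analytic $\mathcal{B}(\mathcal{E})$-valued functions on the unit disc $\mathbb{D}$), where $L_r=(\langle e_1^r,\cdot\rangle\otimes I_{\mathcal{E}})L$ and $\langle e_1^r,\cdot\rangle\otimes I_{\mathcal{E}}:\mathcal{F}_n^2\otimes\mathcal{E}\to\mathcal{E}$ sends $e_\mu\otimes\eta$ to $\eta$ if $e_\mu=e_1^r$ and to $0$ otherwise. $\|\Theta\|_\infty=\sup_{|z|<1}\|\Theta(z)\|$.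
   Formalization: E is assumed nonzero, and for n = 1 it is also assumed that ‖Θ‖∞ ≥ 1: for n = 1, W_L is multiplication by Θ, so L = 0 gives ‖W_L‖ = 0 while the right-hand side is 1; for E = {0} the formula also fails. *)

theory Defs
  imports "HOL-Analysis.Analysis"
begin

section \<open>Complex Hilbert spaces\<close>

text \<open>
  The norm, metric, completeness, bounded linear maps and the operator norm \<^const>\<open>onorm\<close> are those
  of the library's real normed spaces; the classes below only add the complex structure.
  The inner product is conjugate-linear in its first argument.
\<close>

class complex_inner = real_normed_vector +
  fixes scaleC :: "complex \<Rightarrow> 'a \<Rightarrow> 'a" (infixr "*\<^sub>C" 75)
    and cinner :: "'a \<Rightarrow> 'a \<Rightarrow> complex"
  assumes scaleC_add_right: "c *\<^sub>C (x + y) = c *\<^sub>C x + c *\<^sub>C y"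
    and scaleC_add_left: "(c + d) *\<^sub>C x = c *\<^sub>C x + d *\<^sub>C x"
    and scaleC_scaleC: "c *\<^sub>C d *\<^sub>C x = (c * d) *\<^sub>C x"
    and scaleC_one: "1 *\<^sub>C x = x"
    and scaleR_scaleC: "r *\<^sub>R x = complex_of_real r *\<^sub>C x"
    and cinner_commute: "cinner x y = cnj (cinner y x)"
    and cinner_add_right: "cinner x (y + z) = cinner x y + cinner x z"
    and cinner_scaleC_right: "cinner x (c *\<^sub>C y) = c * cinner x y"
    and cinner_norm: "cinner x x = complex_of_real ((norm x)\<^sup>2)"

class chilbert_space = complex_inner + complete_space

subclass (in chilbert_space) banach ..

global_interpretation complex_vector: vector_space "scaleC :: complex \<Rightarrow> 'a \<Rightarrow> 'a::complex_inner"
  by unfold_locales (simp_all add: scaleC_add_right scaleC_add_left scaleC_scaleC scaleC_one)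

locale bounded_clinear = bounded_linear f
  for f :: "'a::complex_inner \<Rightarrow> 'b::complex_inner" +
  assumes scaleC: "f (c *\<^sub>C x) = c *\<^sub>C f x"

lemma cinner_add_left: "cinner (x + y) z = cinner x z + cinner y z"
  by (metis cinner_add_right cinner_commute complex_cnj_add)

lemma cinner_scaleC_left: "cinner (c *\<^sub>C x) y = cnj c * cinner x y"
  by (metis cinner_commute cinner_scaleC_right complex_cnj_mult)

lemma cinner_zero_left [simp]: "cinner 0 x = 0"
  using cinner_add_left[of 0 0 x] by simp

lemma cinner_zero_right [simp]: "cinner x 0 = 0"
  using cinner_add_right[of x 0 0] by simp

lemma norm_scaleC: "norm (c *\<^sub>C x) = cmod c * norm (x::'a::complex_inner)"
proof -
  have "complex_of_real ((norm (c *\<^sub>C x))\<^sup>2) = (c * cnj c) * complex_of_real ((norm x)\<^sup>2)"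
    by (simp only: cinner_norm[symmetric] cinner_scaleC_left cinner_scaleC_right mult.assoc mult.left_commute)
  also have "c * cnj c = complex_of_real ((cmod c)\<^sup>2)"
    by (simp only: complex_norm_square)
  finally have "(norm (c *\<^sub>C x))\<^sup>2 = (cmod c)\<^sup>2 * (norm x)\<^sup>2"
    by (metis of_real_eq_iff of_real_mult)
  then show ?thesis
    by (metis mult_nonneg_nonneg norm_ge_zero power2_eq_iff_nonneg power_mult_distrib)
qed

lemma Cauchy_Schwarz_cinner: "cmod (cinner x y) \<le> norm x * norm (y::'a::complex_inner)"
proof -
  have re: "Re (cinner u v) \<le> norm u * norm v" for u v :: 'a
  proof -
    have "complex_of_real ((norm (u + v))\<^sup>2) = cinner u u + cinner v v + (cinner u v + cinner v u)"
      by (simp add: cinner_norm[symmetric] cinner_add_left cinner_add_right del: of_real_power)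
    also have "\<dots> = complex_of_real ((norm u)\<^sup>2 + (norm v)\<^sup>2 + 2 * Re (cinner u v))"
      by (subst cinner_commute[of v u]) (simp add: cinner_norm complex_add_cnj)
    finally have "(norm (u + v))\<^sup>2 = (norm u)\<^sup>2 + (norm v)\<^sup>2 + 2 * Re (cinner u v)"
      using of_real_eq_iff by blast
    moreover have "(norm (u + v))\<^sup>2 \<le> (norm u + norm v)\<^sup>2"
      by (simp add: norm_triangle_ineq power_mono)
    ultimately show ?thesis by (simp add: power2_sum)
  qed
  obtain c where c: "cmod c = 1" "c * cinner x y = complex_of_real (cmod (cinner x y))"
  proof (cases "cinner x y = 0")
    case True
    then show ?thesis using that[of 1] by simp
  next
    case False
    then show ?thesis
      using that[of "cnj (cinner x y) / complex_of_real (cmod (cinner x y))"]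
      by (simp add: norm_divide complex_norm_square[symmetric] power2_eq_square mult.commute)
  qed
  have "cmod (cinner x y) = Re (cinner x (c *\<^sub>C y))"
    by (simp add: cinner_scaleC_right c)
  also have "\<dots> \<le> norm x * norm (c *\<^sub>C y)" by (rule re)
  finally show ?thesis by (simp add: norm_scaleC c)
qed

lemma bounded_clinear_scaleC: "bounded_clinear (\<lambda>x::'a::complex_inner. c *\<^sub>C x)"
  by unfold_locales
    (auto simp: scaleC_add_right scaleC_scaleC scaleR_scaleC norm_scaleC mult.commute
      intro!: exI[of _ "cmod c"])

instantiation complex :: complex_inner
begin
definition scaleC_complex :: "complex \<Rightarrow> complex \<Rightarrow> complex" where "scaleC_complex c x = c * x"
definition cinner_complex :: "complex \<Rightarrow> complex \<Rightarrow> complex" where "cinner_complex x y = cnj x * y"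
instance
  by standard
    (simp_all add: scaleC_complex_def cinner_complex_def algebra_simps scaleR_conv_of_real
      complex_norm_square[symmetric] del: of_real_power)
end

instance complex :: chilbert_space ..


section \<open>Square-summable families\<close>

typedef (overloaded) ('i, 'e::complex_inner) ell2 =
  "{f :: 'i \<Rightarrow> 'e. (\<lambda>i. (norm (f i))\<^sup>2) summable_on UNIV}"
  morphisms ell2_nth Abs_ell2
  by (rule exI[of _ "\<lambda>_. 0"]) simp

setup_lifting type_definition_ell2

lemma ell2_summable: "(\<lambda>i. (norm (ell2_nth f i))\<^sup>2) summable_on UNIV"
  using ell2_nth[of f] by simp

lemma ell2_summableI:
  assumes "\<And>F. finite F \<Longrightarrow> L2_set (\<lambda>i. norm (f i)) F \<le> K"
  shows "(\<lambda>i. (norm (f i))\<^sup>2) summable_on UNIV"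
proof (rule nonneg_bdd_above_summable_on)
  show "bdd_above (sum (\<lambda>i. (norm (f i))\<^sup>2) ` {F. F \<subseteq> UNIV \<and> finite F})"
  proof (rule bdd_aboveI2)
    fix F assume "F \<in> {F. F \<subseteq> (UNIV::'a set) \<and> finite F}"
    then have "sqrt (sum (\<lambda>i. (norm (f i))\<^sup>2) F) \<le> K"
      using assms[of F] by (simp add: L2_set_def)
    then show "sum (\<lambda>i. (norm (f i))\<^sup>2) F \<le> K\<^sup>2"
      using sqrt_le_D by blast
  qed
qed simp

lemma L2_set_le_norm_aux:
  assumes "(\<lambda>i. (norm (f i))\<^sup>2) summable_on UNIV" "finite F"
  shows "L2_set (\<lambda>i. norm (f i)) F \<le> sqrt (\<Sum>\<^sub>\<infinity>i. (norm (f i))\<^sup>2)"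
  unfolding L2_set_def using assms by (auto intro!: finite_sum_le_infsum)

lemma L2_set_add_le:
  "L2_set (\<lambda>i. norm (f i + g i)) F \<le> L2_set (\<lambda>i. norm (f i)) F + L2_set (\<lambda>i. norm (g i)) F"
  by (rule order_trans[OF L2_set_mono L2_set_triangle_ineq]) (simp_all add: norm_triangle_ineq)

lemma ell2_plus_aux:
  assumes "(\<lambda>i. (norm (f i))\<^sup>2) summable_on UNIV" "(\<lambda>i. (norm (g i))\<^sup>2) summable_on UNIV"
  shows "(\<lambda>i. (norm (f i + g i))\<^sup>2) summable_on UNIV"
  by (rule ell2_summableI, rule order_trans[OF L2_set_add_le],
      rule add_mono[OF L2_set_le_norm_aux[OF assms(1)] L2_set_le_norm_aux[OF assms(2)]])

lemma ell2_scale_aux: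
  assumes "(\<lambda>i. (norm (f i))\<^sup>2) summable_on UNIV"
  shows "(\<lambda>i. (norm (c *\<^sub>C f i))\<^sup>2) summable_on UNIV"
  using summable_on_cmult_right[OF assms] by (simp add: norm_scaleC power_mult_distrib)

instantiation ell2 :: (type, complex_inner) complex_inner
begin

lift_definition zero_ell2 :: "('a, 'b) ell2" is "\<lambda>_. 0" by simp
lift_definition plus_ell2 :: "('a, 'b) ell2 \<Rightarrow> ('a, 'b) ell2 \<Rightarrow> ('a, 'b) ell2" is "\<lambda>f g i. f i + g i"
  by (rule ell2_plus_aux)
lift_definition uminus_ell2 :: "('a, 'b) ell2 \<Rightarrow> ('a, 'b) ell2" is "\<lambda>f i. - f i" by simp
lift_definition minus_ell2 :: "('a, 'b) ell2 \<Rightarrow> ('a, 'b) ell2 \<Rightarrow> ('a, 'b) ell2" is "\<lambda>f g i. f i - g i"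
  subgoal for f g using ell2_plus_aux[of f "\<lambda>i. - g i"] by simp
  done
lift_definition scaleR_ell2 :: "real \<Rightarrow> ('a, 'b) ell2 \<Rightarrow> ('a, 'b) ell2" is "\<lambda>r f i. r *\<^sub>R f i"
  by (simp only: scaleR_scaleC ell2_scale_aux)
lift_definition scaleC_ell2 :: "complex \<Rightarrow> ('a, 'b) ell2 \<Rightarrow> ('a, 'b) ell2" is "\<lambda>c f i. c *\<^sub>C f i"
  by (rule ell2_scale_aux)
definition norm_ell2 :: "('a, 'b) ell2 \<Rightarrow> real"
  where "norm_ell2 f = sqrt (\<Sum>\<^sub>\<infinity>i. (norm (ell2_nth f i))\<^sup>2)"
definition cinner_ell2 :: "('a, 'b) ell2 \<Rightarrow> ('a, 'b) ell2 \<Rightarrow> complex"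
  where "cinner_ell2 f g = (\<Sum>\<^sub>\<infinity>i. cinner (ell2_nth f i) (ell2_nth g i))"
definition sgn_ell2 :: "('a, 'b) ell2 \<Rightarrow> ('a, 'b) ell2" where "sgn_ell2 f = scaleR (inverse (norm f)) f"
definition dist_ell2 :: "('a, 'b) ell2 \<Rightarrow> ('a, 'b) ell2 \<Rightarrow> real" where "dist_ell2 f g = norm (f - g)"
definition uniformity_ell2 :: "(('a, 'b) ell2 \<times> ('a, 'b) ell2) filter"
  where "uniformity_ell2 = (INF e\<in>{0<..}. principal {(x, y). dist x y < e})"
definition open_ell2 :: "('a, 'b) ell2 set \<Rightarrow> bool"
  where "open_ell2 S = (\<forall>x\<in>S. \<forall>\<^sub>F (x', y) in uniformity. x' = x \<longrightarrow> y \<in> S)"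

lemma ell2_eq_iff: "f = g \<longleftrightarrow> (\<forall>i. ell2_nth f i = ell2_nth g i)" for f g :: "('a, 'b) ell2"
  by (auto simp: ell2_nth_inject[symmetric])

lemma L2_set_le_norm: "finite F \<Longrightarrow> L2_set (\<lambda>i. norm (ell2_nth f i)) F \<le> norm f" for f :: "('a, 'b) ell2"
  unfolding norm_ell2_def by (rule L2_set_le_norm_aux[OF ell2_summable])

lemma norm_ell2_le:
  fixes f :: "('a, 'b) ell2"
  assumes "\<And>F. finite F \<Longrightarrow> L2_set (\<lambda>i. norm (ell2_nth f i)) F \<le> K"
  shows "norm f \<le> K"
proof -
  have K: "0 \<le> K" using assms[of "{}"] by simp
  have "(\<Sum>\<^sub>\<infinity>i. (norm (ell2_nth f i))\<^sup>2) \<le> K\<^sup>2"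
  proof (rule infsum_le_finite_sums[OF ell2_summable])
    fix F :: "'a set" assume "finite F"
    from assms[OF this] show "(\<Sum>i\<in>F. (norm (ell2_nth f i))\<^sup>2) \<le> K\<^sup>2"
      unfolding L2_set_def using sqrt_le_D by blast
  qed
  then show ?thesis
    unfolding norm_ell2_def using K by (simp add: real_le_lsqrt infsum_nonneg)
qed

lemma norm_nth_le: "norm (ell2_nth f i) \<le> norm f" for f :: "('a, 'b) ell2"
  using L2_set_le_norm[of "{i}" f] by simp

lemma norm_ell2_sq: "(norm f)\<^sup>2 = (\<Sum>\<^sub>\<infinity>i. (norm (ell2_nth f i))\<^sup>2)" for f :: "('a, 'b) ell2"
  unfolding norm_ell2_def by (simp add: infsum_nonneg)

lemma cinner_ell2_summable:
  "(\<lambda>i. cinner (ell2_nth f i) (ell2_nth g i)) summable_on UNIV" for f g :: "('a, 'b) ell2"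
proof (rule abs_summable_summable, rule Infinite_Sum.abs_summable_on_comparison_test')
  show "(\<lambda>i. (norm (ell2_nth f i))\<^sup>2 + (norm (ell2_nth g i))\<^sup>2) summable_on UNIV"
    by (intro summable_on_add ell2_summable)
  fix i
  have "norm (cinner (ell2_nth f i) (ell2_nth g i)) \<le> norm (ell2_nth f i) * norm (ell2_nth g i)"
    by (rule Cauchy_Schwarz_cinner)
  also have "\<dots> \<le> (norm (ell2_nth f i))\<^sup>2 + (norm (ell2_nth g i))\<^sup>2"
    using sum_squares_bound[of "norm (ell2_nth f i)" "norm (ell2_nth g i)"]
      mult_nonneg_nonneg[OF norm_ge_zero[of "ell2_nth f i"] norm_ge_zero[of "ell2_nth g i"]]
    by linarith
  finally show "norm (cinner (ell2_nth f i) (ell2_nth g i))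
      \<le> (norm (ell2_nth f i))\<^sup>2 + (norm (ell2_nth g i))\<^sup>2" .
qed

instance
proof
  fix f g h :: "('a, 'b) ell2" and r s :: real and c d :: complex
  show "f + g + h = f + (g + h)" by transfer (simp add: add.assoc)
  show "f + g = g + f" by transfer (simp add: add.commute)
  show "0 + f = f" by transfer simp
  show "- f + f = 0" by transfer simp
  show "f - g = f + - g" by transfer simp
  show "r *\<^sub>R (f + g) = r *\<^sub>R f + r *\<^sub>R g" by transfer (simp add: scaleR_add_right)
  show "(r + s) *\<^sub>R f = r *\<^sub>R f + s *\<^sub>R f" by transfer (simp add: scaleR_add_left)
  show "r *\<^sub>R s *\<^sub>R f = (r * s) *\<^sub>R f" by transfer simp
  show "1 *\<^sub>R f = f" by transfer simp
  show "c *\<^sub>C (f + g) = c *\<^sub>C f + c *\<^sub>C g" by transfer (simp add: scaleC_add_right)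
  show "(c + d) *\<^sub>C f = c *\<^sub>C f + d *\<^sub>C f" by transfer (simp add: scaleC_add_left)
  show "c *\<^sub>C d *\<^sub>C f = (c * d) *\<^sub>C f" by transfer (simp add: scaleC_scaleC)
  show "1 *\<^sub>C f = f" by transfer (simp add: scaleC_one)
  show "r *\<^sub>R f = complex_of_real r *\<^sub>C f" by transfer (simp add: scaleR_scaleC)
  show "dist f g = norm (f - g)" by (rule dist_ell2_def)
  show "sgn f = scaleR (inverse (norm f)) f" by (rule sgn_ell2_def)
  show "(uniformity :: (('a, 'b) ell2 \<times> ('a, 'b) ell2) filter)
      = (INF e\<in>{0<..}. principal {(x, y). dist x y < e})"
    by (rule uniformity_ell2_def)
  show "open S = (\<forall>x\<in>S. \<forall>\<^sub>F (x', y) in uniformity. x' = x \<longrightarrow> y \<in> S)" for S :: "('a, 'b) ell2 set"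
    by (rule open_ell2_def)
  show "norm f = 0 \<longleftrightarrow> f = 0"
  proof
    assume "norm f = 0"
    then have "ell2_nth f i = 0" for i using norm_nth_le[of f i] by simp
    then show "f = 0" by (simp add: ell2_eq_iff zero_ell2.rep_eq)
  qed (simp add: norm_ell2_def zero_ell2.rep_eq)
  show "norm (f + g) \<le> norm f + norm g"
    by (rule norm_ell2_le, simp add: plus_ell2.rep_eq, rule order_trans[OF L2_set_add_le])
      (intro add_mono L2_set_le_norm; assumption)
  show "norm (r *\<^sub>R f) = \<bar>r\<bar> * norm f"
    by (simp add: norm_ell2_def scaleR_ell2.rep_eq power_mult_distrib infsum_cmult_right'
        real_sqrt_mult)
  show "cinner f g = cnj (cinner g f)"
    unfolding cinner_ell2_def
    by (subst infsum_cnj[symmetric]) (simp add: cinner_commute[symmetric])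
  show "cinner f (g + h) = cinner f g + cinner f h"
    by (simp add: cinner_ell2_def plus_ell2.rep_eq cinner_add_right infsum_add cinner_ell2_summable)
  show "cinner f (c *\<^sub>C g) = c * cinner f g"
    by (simp add: cinner_ell2_def scaleC_ell2.rep_eq cinner_scaleC_right infsum_cmult_right')
  have "((\<lambda>i. complex_of_real ((norm (ell2_nth f i))\<^sup>2)) has_sum complex_of_real ((norm f)\<^sup>2)) UNIV"
    unfolding norm_ell2_sq by (rule has_sum_of_real, rule has_sum_infsum[OF ell2_summable])
  then show "cinner f f = complex_of_real ((norm f)\<^sup>2)"
    unfolding cinner_ell2_def cinner_norm by (rule infsumI)
qed

end

lemma bounded_clinear_ell2_nth: "bounded_clinear (\<lambda>f. ell2_nth f i)"
  by unfold_locales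
    (auto simp: plus_ell2.rep_eq scaleR_ell2.rep_eq scaleC_ell2.rep_eq
      intro!: exI[of _ 1] norm_nth_le)

instance ell2 :: (type, chilbert_space) chilbert_space
proof
  fix X :: "nat \<Rightarrow> ('a, 'b) ell2"
  assume X: "Cauchy X"
  have "Cauchy (\<lambda>k. ell2_nth (X k) i)" for i
    by (rule bounded_linear.Cauchy[OF _ X]) (rule bounded_clinear.axioms(1)[OF bounded_clinear_ell2_nth])
  then have "\<exists>l. (\<lambda>k. ell2_nth (X k) i) \<longlonglongrightarrow> l" for i
    by (simp add: Cauchy_convergent_iff convergent_def)
  then obtain g where g: "\<And>i. (\<lambda>k. ell2_nth (X k) i) \<longlonglongrightarrow> g i" by metis
  have tail: "L2_set (\<lambda>i. norm (ell2_nth (X m) i - g i)) F \<le> e"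
    if F: "finite F" and N: "\<And>k. k \<ge> N \<Longrightarrow> norm (X m - X k) \<le> e" for F m N e
  proof (rule LIMSEQ_le_const2)
    show "(\<lambda>k. L2_set (\<lambda>i. norm (ell2_nth (X m) i - ell2_nth (X k) i)) F)
        \<longlonglongrightarrow> L2_set (\<lambda>i. norm (ell2_nth (X m) i - g i)) F"
      unfolding L2_set_def by (intro tendsto_intros g)
    show "\<exists>N. \<forall>k\<ge>N. L2_set (\<lambda>i. norm (ell2_nth (X m) i - ell2_nth (X k) i)) F \<le> e"
    proof (intro exI[of _ N] allI impI)
      fix k assume "N \<le> k"
      with N[of k] L2_set_le_norm[OF F, of "X m - X k"]
      show "L2_set (\<lambda>i. norm (ell2_nth (X m) i - ell2_nth (X k) i)) F \<le> e"
        by (simp add: minus_ell2.rep_eq)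
    qed
  qed
  have cau: "\<exists>N. \<forall>m\<ge>N. \<forall>k\<ge>N. norm (X m - X k) \<le> e" if "e > 0" for e
    using CauchyD[OF X that] by (meson less_imp_le)
  obtain N1 where "\<forall>m\<ge>N1. \<forall>k\<ge>N1. norm (X m - X k) \<le> 1" using cau[of 1] by auto
  then have "(\<lambda>i. (norm (ell2_nth (X N1) i - g i))\<^sup>2) summable_on UNIV"
    by (intro ell2_summableI[of _ 1] tail[where N = N1]) auto
  then have "(\<lambda>i. (norm (ell2_nth (X N1) i + (- (ell2_nth (X N1) i - g i))))\<^sup>2) summable_on UNIV"
    by (intro ell2_plus_aux ell2_summable) (simp add: norm_minus_commute)
  then have "(\<lambda>i. (norm (g i))\<^sup>2) summable_on UNIV" by simp
  then have G: "ell2_nth (Abs_ell2 g) = g" by (simp add: Abs_ell2_inverse)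
  have "X \<longlonglongrightarrow> Abs_ell2 g"
  proof (rule metric_LIMSEQ_I)
    fix r :: real assume "0 < r"
    then obtain N where N: "\<And>m k. m \<ge> N \<Longrightarrow> k \<ge> N \<Longrightarrow> norm (X m - X k) \<le> r / 2"
      using cau[of "r / 2"] by auto
    have "norm (X m - Abs_ell2 g) \<le> r / 2" if "m \<ge> N" for m
      by (rule norm_ell2_le, simp only: minus_ell2.rep_eq G, rule tail[where N = N])
        (use N that in auto)
    with \<open>0 < r\<close> show "\<exists>N. \<forall>m\<ge>N. dist (X m) (Abs_ell2 g) < r"
      by (intro exI[of _ N]) (fastforce simp: dist_norm)
  qed
  then show "convergent X" by (rule convergentI)
qed


section \<open>The space \<open>F\<^sub>n\<^sup>2 \<otimes> E\<close>\<close>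

text \<open>
  The letters \<open>1 < \<dots> < n\<close> are the elements of a finite linear order \<open>'n\<close>, so \<open>n = CARD('n) \<ge> 1\<close>.
  Words are lists of letters.  Since the \<open>e\<^sub>\<mu>\<close> form an orthonormal basis of the full Fock space,
  \<open>F\<^sub>n\<^sup>2 \<otimes> E\<close> is the space of square-summable families \<open>(f\<^sub>\<mu>)\<close> in \<open>E\<close> indexed by words, the family
  \<open>f\<close> standing for the sum of the \<open>e\<^sub>\<mu> \<otimes> f\<^sub>\<mu>\<close>.
  The lemmas \<open>cinner_etens\<close> and \<open>closure_span_etens\<close> below characterise this tensor product.
\<close>

type_synonym ('n, 'e) fock = "('n list, 'e) ell2"

lift_definition etens :: "'n list \<Rightarrow> 'e::complex_inner \<Rightarrow> ('n, 'e) fock"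
  is "\<lambda>\<mu> \<eta> \<nu>. if \<nu> = \<mu> then \<eta> else 0"
  subgoal for \<mu> \<eta>
    by (subst summable_on_cong_neutral[where T = "{\<mu>}" and g = "\<lambda>_. (norm \<eta>)\<^sup>2"]) auto
  done

text \<open>\<open>ltens \<alpha> f\<close> is \<open>e\<^sub>\<alpha> \<otimes> f\<close>.\<close>

lift_definition ltens :: "'n list \<Rightarrow> ('n, 'e::complex_inner) fock \<Rightarrow> ('n, 'e) fock"
  is "\<lambda>\<alpha> f \<mu>. if take (length \<alpha>) \<mu> = \<alpha> then f (drop (length \<alpha>) \<mu>) else 0"
  subgoal premises prems for \<alpha> f
  proof -
    have "inj ((@) \<alpha>)" by (simp add: inj_on_def)
    from summable_on_reindex[OF this, of "\<lambda>\<mu>. (norm (f (drop (length \<alpha>) \<mu>)))\<^sup>2"] prems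
    have "(\<lambda>\<mu>. (norm (f (drop (length \<alpha>) \<mu>)))\<^sup>2) summable_on range ((@) \<alpha>)"
      by (simp add: o_def)
    moreover have "take (length \<alpha>) \<mu> = \<alpha> \<longleftrightarrow> \<mu> \<in> range ((@) \<alpha>)" for \<mu>
      by (metis append_eq_conv_conj append_take_drop_id rangeE rangeI)
    ultimately show ?thesis
      by (subst summable_on_cong_neutral[where T = "range ((@) \<alpha>)"
            and g = "\<lambda>\<mu>. (norm (f (drop (length \<alpha>) \<mu>)))\<^sup>2"]) auto
  qed
  done

text \<open>\<open>eslice \<mu>\<close> is \<open>\<langle>e\<^sub>\<mu>, \<cdot>\<rangle> \<otimes> I\<^sub>E\<close>.\<close>

definition eslice :: "'n list \<Rightarrow> ('n, 'e::complex_inner) fock \<Rightarrow> 'e"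
  where "eslice \<mu> f = ell2_nth f \<mu>"

lemma eslice_etens: "eslice \<mu> (etens \<nu> \<eta>) = (if \<nu> = \<mu> then \<eta> else 0)"
  by (auto simp: eslice_def etens.rep_eq)

lemma bounded_clinear_eslice: "bounded_clinear (eslice \<mu>)"
  using bounded_clinear_ell2_nth[of \<mu>] by (simp add: eslice_def[abs_def])

lemma ltens_etens: "ltens \<alpha> (etens \<mu> \<eta>) = etens (\<alpha> @ \<mu>) \<eta>"
  unfolding ell2_eq_iff ltens.rep_eq etens.rep_eq
  by (metis append_eq_conv_conj append_take_drop_id)

lemma cinner_etens: "cinner (etens \<mu> \<xi>) (etens \<nu> \<eta>) = (if \<mu> = \<nu> then cinner \<xi> \<eta> else 0)"
proof -
  have "cinner (etens \<mu> \<xi>) (etens \<nu> \<eta>)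
      = (\<Sum>\<^sub>\<infinity>\<kappa>\<in>{\<mu>}. if \<mu> = \<nu> then cinner \<xi> \<eta> else 0)"
    unfolding cinner_ell2_def etens.rep_eq by (rule infsum_cong_neutral) auto
  then show ?thesis by simp
qed

lemma norm_etens: "norm (etens \<mu> \<eta>) = norm \<eta>"
  using cinner_etens[of \<mu> \<eta> \<mu> \<eta>] unfolding cinner_norm
  by (simp del: of_real_power)

lemma bounded_clinear_etens: "bounded_clinear (etens \<mu> :: 'e::complex_inner \<Rightarrow> ('n, 'e) fock)"
proof unfold_locales
  show "etens \<mu> (x + y) = etens \<mu> x + etens \<mu> y" for x y :: 'e
    by transfer auto
  show "etens \<mu> (r *\<^sub>R x) = r *\<^sub>R etens \<mu> x" for r and x :: 'e
    by transfer auto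
  show "etens \<mu> (c *\<^sub>C x) = c *\<^sub>C etens \<mu> x" for c and x :: 'e
    by transfer auto
  show "\<exists>K. \<forall>x :: 'e. norm (etens \<mu> x) \<le> norm x * K"
    by (intro exI[of _ 1]) (simp add: norm_etens)
qed

lemma bounded_clinear_ltens:
  "bounded_clinear (ltens \<alpha> :: ('n, 'e::complex_inner) fock \<Rightarrow> ('n, 'e) fock)"
proof unfold_locales
  show "ltens \<alpha> (x + y) = ltens \<alpha> x + ltens \<alpha> y" for x y :: "('n, 'e) fock"
    by transfer auto
  show "ltens \<alpha> (r *\<^sub>R x) = r *\<^sub>R ltens \<alpha> x" for r and x :: "('n, 'e) fock"
    by transfer auto
  show "ltens \<alpha> (c *\<^sub>C x) = c *\<^sub>C ltens \<alpha> x" for c and x :: "('n, 'e) fock"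
    by transfer auto
  have "norm (ltens \<alpha> x) = norm x" for x :: "('n, 'e) fock"
  proof -
    have "(\<Sum>\<^sub>\<infinity>\<mu>. (norm (ell2_nth (ltens \<alpha> x) \<mu>))\<^sup>2)
        = (\<Sum>\<^sub>\<infinity>\<mu>\<in>range ((@) \<alpha>). (norm (ell2_nth x (drop (length \<alpha>) \<mu>)))\<^sup>2)"
      unfolding ltens.rep_eq
      by (rule infsum_cong_neutral) (auto, metis append_take_drop_id rangeI)
    also have "\<dots> = (\<Sum>\<^sub>\<infinity>\<mu>. (norm (ell2_nth x \<mu>))\<^sup>2)"
      by (subst infsum_reindex) (simp_all add: inj_on_def o_def)
    finally show ?thesis by (simp add: norm_ell2_def)
  qed
  then show "\<exists>K. \<forall>x :: ('n, 'e) fock. norm (ltens \<alpha> x) \<le> norm x * K"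
    by (intro exI[of _ 1]) simp
qed

lemma closure_span_etens:
  "closure (complex_vector.span (range (\<lambda>(\<mu>, \<eta>). etens \<mu> \<eta>))) = (UNIV :: ('n, 'e::complex_inner) fock set)"
proof -
  have "f \<in> closure (complex_vector.span (range (\<lambda>(\<mu>, \<eta>). etens \<mu> \<eta>)))" for f :: "('n, 'e) fock"
    unfolding closure_approachable
  proof (intro allI impI)
    fix e :: real assume "e > 0"
    let ?a = "\<lambda>\<mu>. (norm (ell2_nth f \<mu>))\<^sup>2"
    obtain F where F: "finite F" "dist (sum ?a F) (infsum ?a UNIV) \<le> (e / 2)\<^sup>2"
      using infsum_finite_approximation[OF ell2_summable, of "(e / 2)\<^sup>2" f] \<open>e > 0\<close> by auto
    define g where "g = (\<Sum>\<mu>\<in>F. etens \<mu> (ell2_nth f \<mu>))"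
    have nth_sum: "ell2_nth (sum h S) i = (\<Sum>\<mu>\<in>S. ell2_nth (h \<mu>) i)"
      for h :: "'n list \<Rightarrow> ('n, 'e) fock" and S i
      by (induction S rule: infinite_finite_induct) (simp_all add: zero_ell2.rep_eq plus_ell2.rep_eq)
    have g: "ell2_nth g i = (if i \<in> F then ell2_nth f i else 0)" for i
      using F(1) by (simp add: g_def nth_sum etens.rep_eq)
    have "norm (g - f) \<le> e / 2"
    proof (rule norm_ell2_le)
      fix G :: "'n list set" assume G: "finite G"
      have "(\<Sum>\<mu>\<in>G. (norm (ell2_nth (g - f) \<mu>))\<^sup>2) = sum ?a (G - F)"
        by (rule sum.mono_neutral_cong_right) (use G in \<open>auto simp: minus_ell2.rep_eq g\<close>)
      also have "\<dots> = sum ?a (F \<union> (G - F)) - sum ?a F"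
        by (subst sum.union_disjoint) (use F G in auto)
      also have "\<dots> \<le> infsum ?a UNIV - sum ?a F"
        by (intro diff_right_mono finite_sum_le_infsum ell2_summable) (use F G in auto)
      also have "\<dots> \<le> (e / 2)\<^sup>2"
        using F(2) by (simp add: dist_real_def)
      finally show "L2_set (\<lambda>\<mu>. norm (ell2_nth (g - f) \<mu>)) G \<le> e / 2"
        unfolding L2_set_def using \<open>e > 0\<close> by (intro real_le_lsqrt) auto
    qed
    moreover have "g \<in> complex_vector.span (range (\<lambda>(\<mu>, \<eta>). etens \<mu> \<eta>))"
      unfolding g_def by (intro complex_vector.span_sum complex_vector.span_base) auto
    ultimately show "\<exists>y\<in>complex_vector.span (range (\<lambda>(\<mu>, \<eta>). etens \<mu> \<eta>)). dist y f < e"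
      using \<open>e > 0\<close> by (intro bexI[of _ g]) (auto simp: dist_norm)
  qed
  then show ?thesis by blast
qed


section \<open>Odometer maps\<close>

definition first_letter :: "'n::{finite, linorder}" where "first_letter = Min UNIV"
definition last_letter :: "'n::{finite, linorder}" where "last_letter = Max UNIV"

text \<open>Only meaningful for \<open>a \<noteq> last_letter\<close>.\<close>

definition next_letter :: "'n::{finite, linorder} \<Rightarrow> 'n" where "next_letter a = Min {b. a < b}"

text \<open>
  The index \<open>k\<close> is counted from \<open>0\<close>.  Since the vectors \<open>e\<^sub>\<mu> \<otimes> \<eta>\<close> span a dense subspace, at most one
  bounded operator \<open>W\<close> satisfies this predicate for a given \<open>L\<close>.
\<close>

definition odometer_map ::
    "('e::complex_inner \<Rightarrow> ('n::{finite, linorder}, 'e) fock) \<Rightarrow> (('n, 'e) fock \<Rightarrow> ('n, 'e) fock) \<Rightarrow> bool"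
  where "odometer_map L W \<longleftrightarrow>
    bounded_clinear W \<and>
    (\<forall>\<eta>. W (etens [] \<eta>) = L \<eta>) \<and>
    (\<forall>m\<ge>1. \<forall>\<eta>. W (etens (replicate m last_letter) \<eta>) = ltens (replicate m first_letter) (L \<eta>)) \<and>
    (\<forall>\<mu> \<eta>. (\<exists>a\<in>set \<mu>. a \<noteq> last_letter) \<longrightarrow>
      (let k = (LEAST i. i < length \<mu> \<and> \<mu> ! i \<noteq> last_letter)
       in W (etens \<mu> \<eta>) =
            etens (replicate k first_letter @ [next_letter (\<mu> ! k)] @ drop (Suc k) \<mu>) \<eta>))"

definition M_perp :: "('n::{finite, linorder}, 'e::complex_inner) fock set"
  where "M_perp = closure (complex_vector.span {etens (replicate m first_letter) \<xi> | m \<xi>. True})"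

definition symbol_coeff ::
    "('e::complex_inner \<Rightarrow> ('n::{finite, linorder}, 'e) fock) \<Rightarrow> nat \<Rightarrow> 'e \<Rightarrow> 'e"
  where "symbol_coeff L r \<eta> = eslice (replicate r first_letter) (L \<eta>)"

text \<open>
  The series is summed pointwise on \<open>E\<close>; as the coefficients are bounded by the norm of \<open>L\<close>, it
  converges for \<open>cmod z < 1\<close>, to a bounded operator.
\<close>

definition analytic_symbol ::
    "('e::complex_inner \<Rightarrow> ('n::{finite, linorder}, 'e) fock) \<Rightarrow> complex \<Rightarrow> 'e \<Rightarrow> 'e"
  where "analytic_symbol L z \<eta> = (\<Sum>r. z ^ r *\<^sub>C symbol_coeff L r \<eta>)"

lemma analytic_symbol:
  fixes L :: "'e::chilbert_space \<Rightarrow> ('n::{finite, linorder}, 'e) fock"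
  assumes L: "bounded_clinear L" and z: "cmod z < 1"
  shows analytic_symbol_sums: "(\<lambda>r. z ^ r *\<^sub>C symbol_coeff L r \<eta>) sums analytic_symbol L z \<eta>"
    and bounded_clinear_analytic_symbol: "bounded_clinear (analytic_symbol L z)"
proof -
  interpret L: bounded_clinear L by (rule L)
  obtain K where K: "\<And>\<eta>. norm (L \<eta>) \<le> norm \<eta> * K" using L.bounded by blast
  have le: "norm (z ^ r *\<^sub>C symbol_coeff L r \<eta>) \<le> cmod z ^ r * (norm \<eta> * K)" for r \<eta>
    unfolding norm_scaleC norm_power symbol_coeff_def eslice_def
    by (intro mult_left_mono order_trans[OF norm_nth_le K]) auto
  have geo: "summable (\<lambda>r. cmod z ^ r * (norm \<eta> * K))" for \<eta> :: 'e
    by (intro summable_mult2 summable_geometric) (use z in simp)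
  have sm: "summable (\<lambda>r. z ^ r *\<^sub>C symbol_coeff L r \<eta>)" for \<eta>
    by (rule summable_norm_cancel, rule summable_comparison_test'[OF geo]) (use le in auto)
  then show "(\<lambda>r. z ^ r *\<^sub>C symbol_coeff L r \<eta>) sums analytic_symbol L z \<eta>"
    unfolding analytic_symbol_def by (rule summable_sums)
  have add: "symbol_coeff L r (x + y) = symbol_coeff L r x + symbol_coeff L r y" for r x y
    by (simp add: symbol_coeff_def eslice_def L.add plus_ell2.rep_eq)
  have scl: "symbol_coeff L r (c *\<^sub>C x) = c *\<^sub>C symbol_coeff L r x" for r x c
    by (simp add: symbol_coeff_def eslice_def L.scaleC scaleC_ell2.rep_eq)
  have C: "analytic_symbol L z (c *\<^sub>C x) = c *\<^sub>C analytic_symbol L z x" for c x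
  proof -
    interpret S: bounded_clinear "\<lambda>x::'e. c *\<^sub>C x" by (rule bounded_clinear_scaleC)
    show ?thesis
      unfolding analytic_symbol_def S.suminf[OF sm] scl by (simp add: scaleC_scaleC mult.commute)
  qed
  show "bounded_clinear (analytic_symbol L z)"
  proof unfold_locales
    show "analytic_symbol L z (x + y) = analytic_symbol L z x + analytic_symbol L z y" for x y
      unfolding analytic_symbol_def suminf_add[OF sm sm] add by (simp add: scaleC_add_right)
    show "analytic_symbol L z (r *\<^sub>R x) = r *\<^sub>R analytic_symbol L z x" for r x
      unfolding scaleR_scaleC by (rule C)
    show "analytic_symbol L z (c *\<^sub>C x) = c *\<^sub>C analytic_symbol L z x" for c x by (rule C)
    have "norm (analytic_symbol L z x) \<le> norm x * (K * (\<Sum>r. cmod z ^ r))" for x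
    proof -
      have "norm (analytic_symbol L z x) \<le> (\<Sum>r. cmod z ^ r * (norm x * K))"
        unfolding analytic_symbol_def by (rule norm_suminf_le[OF le geo])
      also have "\<dots> = (\<Sum>r. cmod z ^ r) * (norm x * K)"
        by (rule suminf_mult2[symmetric], rule summable_geometric) (use z in simp)
      finally show ?thesis by (simp add: mult_ac)
    qed
    then show "\<exists>K. \<forall>x. norm (analytic_symbol L z x) \<le> norm x * K" by blast
  qed
qed

text \<open>
  Extended-real valued, so that an equation for it also asserts boundedness on the disc.
\<close>

definition Hinf_norm :: "(complex \<Rightarrow> 'e::complex_inner \<Rightarrow> 'e) \<Rightarrow> ereal"
  where "Hinf_norm \<Theta> = (SUP z\<in>ball 0 1. ereal (onorm (\<Theta> z)))"

end

(*
  On words with a letter other than the last one, W is induced by an injective map into words with a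
  letter other than the first one, hence isometric. On powers of the last letter it is, up to
  relabelling, multiplication by \<Theta> on the Hardy space, with orthogonal range. So the norm is the
  maximum of 1 and the norm of the multiplication operator. The latter is at least the supremum
  of \<Theta> by testing on Szego kernels, and at most that by Parseval's identity on circles of radius
  r < 1, which is used in its discrete form at K-th roots of unity with K \<rightarrow> \<infinity>, so that no
  vector-valued integral is needed.
*)
theory Submission
  imports Defs
begin

section \<open>Inner products and finite sums\<close>

lemma cinner_sum_right: "cinner x (sum f A) = (\<Sum>i\<in>A. cinner x (f i))"
  by (induction A rule: infinite_finite_induct) (simp_all add: cinner_add_right)

lemma cinner_sum_left: "cinner (sum f A) x = (\<Sum>i\<in>A. cinner (f i) x)"
  by (induction A rule: infinite_finite_induct) (simp_all add: cinner_add_left)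

lemma norm_add_sq_orthogonal:
  fixes x y :: "'a::complex_inner"
  assumes "cinner x y = 0"
  shows "(norm (x + y))\<^sup>2 = (norm x)\<^sup>2 + (norm y)\<^sup>2"
proof -
  have "cinner y x = 0" by (subst cinner_commute) (simp add: assms)
  then have "complex_of_real ((norm (x + y))\<^sup>2) = complex_of_real ((norm x)\<^sup>2 + (norm y)\<^sup>2)"
    using assms
    by (simp add: cinner_norm[symmetric] cinner_add_left cinner_add_right del: of_real_power)
  then show ?thesis using of_real_eq_iff by blast
qed

text \<open>Writing \<open>w i\<close> for the \<open>i\<close>-th root of unity,
  \<open>w j ^ k = w k ^ j\<close>, so the sum over \<open>j\<close> is geometric with ratio
  \<open>cnj (w k) * w l\<close>. This ratio is itself a \<open>K\<close>-th root of unity, and it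
  equals 1 only for \<open>k = l\<close> because the roots with index below \<open>K\<close> are
  distinct.\<close>

lemma sum_roots_unity_powers:
  assumes "k < K" "l < K"
  shows "(\<Sum>j<K. cnj (cis (2 * pi * real j / real K) ^ k) * cis (2 * pi * real j / real K) ^ l)
    = (if k = l then of_nat K else 0)"
proof -
  define w where "w i = cis (2 * pi * real i / real K)" for i
  have K: "K > 0" using assms by simp
  have w: "w j ^ i = w i ^ j" for i j
    by (simp add: w_def Complex.DeMoivre mult_ac)
  have unit: "cnj (w i) * w i = 1" for i by (simp add: w_def cis_cnj cis_mult)
  have "(\<Sum>j<K. cnj (w j ^ k) * w j ^ l) = (\<Sum>j<K. (cnj (w k) * w l) ^ j)"
    by (simp add: w[of _ k] w[of _ l] power_mult_distrib)
  also have "\<dots> = (if k = l then of_nat K else 0)"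
  proof (cases "k = l")
    case True
    then show ?thesis by (simp add: unit)
  next
    case False
    have "w i ^ K = 1" for i using K by (simp add: w_def Complex.DeMoivre)
    then have "(cnj (w k) * w l) ^ K = 1" by (simp add: power_mult_distrib flip: complex_cnj_power)
    moreover have "cnj (w k) * w l \<noteq> 1"
    proof
      assume "cnj (w k) * w l = 1"
      moreover have "w k * (cnj (w k) * w l) = (cnj (w k) * w k) * w l" by (simp only: mult_ac)
      ultimately have "w l = w k" by (simp add: unit)
      then show False
        using Complex.bij_betw_roots_unity[OF K] assms False
        unfolding bij_betw_def w_def inj_on_def by auto
    qed
    ultimately show ?thesis using False by (simp add: sum_gp_strict)
  qed
  finally show ?thesis by (simp add: w_def)
qed

text \<open>Discrete Parseval identity: after expanding the squares, summation over the
  \<open>K\<close>-th roots of unity removes all mixed terms, since both indices stay below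
  \<open>K\<close>.\<close>

lemma parseval_roots_unity:
  fixes x :: "nat \<Rightarrow> 'a::complex_inner"
  shows "(\<Sum>j<K. (norm (\<Sum>k<K. cis (2 * pi * real j / real K) ^ k *\<^sub>C x k))\<^sup>2)
    = real K * (\<Sum>k<K. (norm (x k))\<^sup>2)"
proof -
  define w where "w j = cis (2 * pi * real j / real K)" for j
  have "complex_of_real (\<Sum>j<K. (norm (\<Sum>k<K. w j ^ k *\<^sub>C x k))\<^sup>2)
      = (\<Sum>j<K. \<Sum>k<K. \<Sum>l<K. cnj (w j ^ k) * w j ^ l * cinner (x k) (x l))"
    by (simp add: cinner_norm[symmetric] cinner_sum_left cinner_sum_right cinner_scaleC_left
        cinner_scaleC_right sum_distrib_left mult_ac del: of_real_power)
      (rule sum.cong[OF refl], rule sum.swap)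
  also have "\<dots> = (\<Sum>k<K. \<Sum>j<K. \<Sum>l<K. cnj (w j ^ k) * w j ^ l * cinner (x k) (x l))"
    by (rule sum.swap)
  also have "\<dots> = (\<Sum>k<K. \<Sum>l<K. (\<Sum>j<K. cnj (w j ^ k) * w j ^ l) * cinner (x k) (x l))"
    unfolding sum_distrib_right by (rule sum.cong[OF refl], rule sum.swap)
  also have "\<dots> = (\<Sum>k<K. \<Sum>l<K. (if k = l then of_nat K else 0) * cinner (x k) (x l))"
    by (intro sum.cong refl arg_cong2[where f = times])
      (simp add: w_def sum_roots_unity_powers[simplified])
  also have "\<dots> = (\<Sum>k<K. of_nat K * cinner (x k) (x k))"
    by (simp add: if_distrib[of "\<lambda>c. c * _"] cong: if_cong)
  also have "\<dots> = complex_of_real (real K * (\<Sum>k<K. (norm (x k))\<^sup>2))"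
    by (simp add: cinner_norm sum_distrib_left)
  finally show ?thesis unfolding w_def using of_real_eq_iff by blast
qed


section \<open>Finitely supported families\<close>

lemma ell2_nth_sum: "ell2_nth (sum h S) i = (\<Sum>\<mu>\<in>S. ell2_nth (h \<mu>) i)"
  by (induction S rule: infinite_finite_induct) (simp_all add: zero_ell2.rep_eq plus_ell2.rep_eq)

lemma cinner_ell2_disjoint:
  assumes "\<And>i. ell2_nth f i = 0 \<or> ell2_nth g i = 0"
  shows "cinner f g = 0"
proof -
  have "cinner (ell2_nth f i) (ell2_nth g i) = 0" for i using assms[of i] by auto
  then show ?thesis by (simp add: cinner_ell2_def)
qed

text \<open>The relabelling \<open>p\<close> is kept general to cover powers of the last letter, the
  identity and \<open>succ_word\<close> alike.\<close>

lemma norm_sum_etens: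
  assumes "finite F" "inj_on p F"
  shows "(norm (\<Sum>\<mu>\<in>F. etens (p \<mu>) (x \<mu>)))\<^sup>2 = (\<Sum>\<mu>\<in>F. (norm (x \<mu>))\<^sup>2)"
  using assms
proof (induction F rule: finite_induct)
  case (insert \<mu> F)
  have "cinner (etens (p \<mu>) (x \<mu>)) (\<Sum>\<mu>\<in>F. etens (p \<mu>) (x \<mu>)) = 0"
    unfolding cinner_sum_right cinner_etens
    by (rule sum.neutral) (use insert.prems insert.hyps in \<open>auto simp: inj_on_def\<close>)
  with insert show ?case by (simp add: norm_add_sq_orthogonal norm_etens)
qed simp

lemma finite_support_expansion:
  assumes "finite G" "{\<mu>. ell2_nth f \<mu> \<noteq> 0} \<subseteq> G"
  shows "f = (\<Sum>\<mu>\<in>G. etens \<mu> (ell2_nth f \<mu>))"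
  unfolding ell2_eq_iff ell2_nth_sum etens.rep_eq using assms by (auto simp: subset_eq)

text \<open>These families form a subspace containing every elementary tensor, and the elementary
  tensors have dense span.\<close>

lemma closure_finite_support:
  "closure {f :: ('n, 'e::complex_inner) fock. finite {\<mu>. ell2_nth f \<mu> \<noteq> 0}} = UNIV"
proof -
  let ?S = "{f :: ('n, 'e) fock. finite {\<mu>. ell2_nth f \<mu> \<noteq> 0}}"
  have sub: "complex_vector.subspace ?S"
  proof (rule complex_vector.subspaceI)
    fix f g :: "('n, 'e) fock" assume "f \<in> ?S" "g \<in> ?S"
    then have "finite ({\<mu>. ell2_nth f \<mu> \<noteq> 0} \<union> {\<mu>. ell2_nth g \<mu> \<noteq> 0})" by simp
    then show "f + g \<in> ?S"
      by (simp, elim rev_finite_subset) (auto simp: plus_ell2.rep_eq)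
  next
    fix c and f :: "('n, 'e) fock" assume "f \<in> ?S"
    then show "c *\<^sub>C f \<in> ?S"
      by (simp, elim rev_finite_subset) (auto simp: scaleC_ell2.rep_eq)
  qed (simp add: zero_ell2.rep_eq)
  have "range (\<lambda>(\<mu>, \<eta>). etens \<mu> \<eta>) \<subseteq> ?S"
    by (auto simp: etens.rep_eq)
  then have "complex_vector.span (range (\<lambda>(\<mu>, \<eta>). etens \<mu> \<eta>)) \<subseteq> ?S"
    by (rule complex_vector.span_minimal[OF _ sub])
  from closure_mono[OF this] show ?thesis unfolding closure_span_etens by auto
qed

text \<open>The inequality defines a closed set of vectors, so density reduces norm estimates to
  finite sums, on which an odometer map can be computed word by word.\<close>

lemma bounded_linear_fock_le:
  fixes W :: "('n, 'e::complex_inner) fock \<Rightarrow> 'b::real_normed_vector"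
  assumes W: "bounded_linear W"
    and le: "\<And>f. finite {\<mu>. ell2_nth f \<mu> \<noteq> 0} \<Longrightarrow> norm (W f) \<le> C * norm f"
  shows "norm (W f) \<le> C * norm f"
proof -
  interpret bounded_linear W by (rule W)
  have "closed {f. norm (W f) \<le> C * norm f}"
    by (intro closed_Collect_le continuous_intros continuous_on)
  then have "closure {f. finite {\<mu>. ell2_nth f \<mu> \<noteq> 0}} \<subseteq> {f. norm (W f) \<le> C * norm f}"
    by (intro closure_minimal) (auto intro: le)
  then show ?thesis unfolding closure_finite_support by auto
qed


section \<open>Evaluation of the analytic part\<close>

text \<open>Value at \<open>z\<close> of the Hardy space function whose coefficients are the
  components of \<open>h\<close> at powers of the first letter. It treats the symbol, which is the
  value of \<open>L \<eta>\<close>, and images under the odometer map in the same way.\<close>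

definition fock_eval :: "complex \<Rightarrow> ('n::{finite, linorder}, 'e::complex_inner) fock \<Rightarrow> 'e"
  where "fock_eval z h = (\<Sum>k. z ^ k *\<^sub>C eslice (replicate k first_letter) h)"

lemma analytic_symbol_eq_fock_eval: "analytic_symbol L z \<eta> = fock_eval z (L \<eta>)"
  by (simp add: analytic_symbol_def symbol_coeff_def fock_eval_def)

lemma L2_set_replicate_le_norm:
  "L2_set (\<lambda>k. norm (ell2_nth f (replicate k a))) {..<K} \<le> norm f"
proof -
  have "inj_on (\<lambda>k. replicate k a) {..<K}"
    by (rule inj_on_inverseI[where g = length]) simp
  then have "L2_set (\<lambda>k. norm (ell2_nth f (replicate k a))) {..<K}
      = L2_set (\<lambda>\<mu>. norm (ell2_nth f \<mu>)) ((\<lambda>k. replicate k a) ` {..<K})"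
    by (simp add: L2_set_def sum.reindex)
  then show ?thesis by (simp add: L2_set_le_norm)
qed

section \<open>Convergence, bounds and shifts for evaluation at a point of the disc\<close>

context
  fixes z :: complex
  assumes z: "cmod z < 1"
begin

lemma norm_fock_eval_term:
  "norm (z ^ k *\<^sub>C eslice \<mu> h) \<le> cmod z ^ k * norm h" for h :: "('n, 'e::complex_inner) fock"
  unfolding norm_scaleC norm_power eslice_def by (intro mult_left_mono norm_nth_le) simp

lemma summable_fock_eval:
  "summable (\<lambda>k. z ^ k *\<^sub>C eslice (replicate k a) h)" for h :: "('n, 'e::chilbert_space) fock"
  by (rule summable_norm_cancel, rule summable_comparison_test'[where g = "\<lambda>k. cmod z ^ k * norm h"])
    (use z norm_fock_eval_term in \<open>auto intro!: summable_mult2 summable_geometric\<close>)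

text \<open>The bound depends on \<open>z\<close> only through \<open>cmod z\<close>, so it is
  uniform on circles; it allows the series to be replaced by a polynomial at all roots of unity at
  once.\<close>

lemma norm_fock_eval_tail:
  fixes h :: "('n::{finite, linorder}, 'e::chilbert_space) fock"
  shows "norm (fock_eval z h - (\<Sum>k<K. z ^ k *\<^sub>C eslice (replicate k first_letter) h))
    \<le> cmod z ^ K * (norm h / (1 - cmod z))"
proof -
  let ?t = "\<lambda>k. z ^ k *\<^sub>C eslice (replicate k first_letter) h"
  have geo: "summable (\<lambda>k. cmod z ^ (k + K) * norm h)"
    using z by (intro summable_mult2 summable_ignore_initial_segment summable_geometric) simp
  have "fock_eval z h - sum ?t {..<K} = (\<Sum>k. ?t (k + K))"
    unfolding fock_eval_def by (rule suminf_minus_initial_segment[symmetric, OF summable_fock_eval])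
  also have "norm \<dots> \<le> (\<Sum>k. cmod z ^ (k + K) * norm h)"
    by (rule norm_suminf_le[OF norm_fock_eval_term geo])
  also have "\<dots> = cmod z ^ K * norm h * (\<Sum>k. cmod z ^ k)"
    using z by (subst suminf_mult[symmetric]) (auto intro: summable_geometric simp: power_add mult_ac)
  also have "\<dots> = cmod z ^ K * (norm h / (1 - cmod z))"
    using z by (simp add: suminf_geometric)
  finally show ?thesis .
qed

text \<open>Cauchy-Schwarz against the powers of \<open>z\<close>. The constant is the norm of the
  Szego kernel at \<open>z\<close>; this exact value is what later cancels in the lower bound for
  the odometer map.\<close>

lemma norm_fock_eval_le:
  fixes h :: "('n::{finite, linorder}, 'e::chilbert_space) fock"
  shows "norm (fock_eval z h) \<le> norm h / sqrt (1 - (cmod z)\<^sup>2)"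
proof (rule LIMSEQ_le_const2)
  let ?t = "\<lambda>k. z ^ k *\<^sub>C eslice (replicate k first_letter) h"
  show "(\<lambda>K. norm (sum ?t {..<K})) \<longlonglongrightarrow> norm (fock_eval z h)"
    unfolding fock_eval_def by (intro tendsto_norm summable_LIMSEQ summable_fock_eval)
  have z2: "(cmod z)\<^sup>2 < 1" using z by (simp add: power_less_one_iff)
  have "norm (sum ?t {..<K}) \<le> norm h / sqrt (1 - (cmod z)\<^sup>2)" for K
  proof -
    have "(\<Sum>k<K. (cmod z ^ k)\<^sup>2) \<le> (\<Sum>k. ((cmod z)\<^sup>2) ^ k)"
      unfolding power_mult[symmetric] mult.commute[of _ 2]
      unfolding power_mult
      by (rule sum_le_suminf) (use z2 in \<open>auto intro: summable_geometric\<close>)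
    also have "\<dots> = 1 / (1 - (cmod z)\<^sup>2)" using z2 by (intro suminf_geometric) simp
    finally have L2z: "L2_set (\<lambda>k. cmod z ^ k) {..<K} \<le> 1 / sqrt (1 - (cmod z)\<^sup>2)"
      unfolding L2_set_def by (metis real_sqrt_le_iff real_sqrt_divide real_sqrt_one)
    have "norm (sum ?t {..<K})
        \<le> (\<Sum>k<K. \<bar>cmod z ^ k\<bar> * \<bar>norm (ell2_nth h (replicate k first_letter))\<bar>)"
      by (rule sum_norm_le) (simp add: norm_scaleC norm_power eslice_def)
    also have "\<dots> \<le> L2_set (\<lambda>k. cmod z ^ k) {..<K}
        * L2_set (\<lambda>k. norm (ell2_nth h (replicate k first_letter))) {..<K}"
      by (rule L2_set_mult_ineq)
    also have "\<dots> \<le> 1 / sqrt (1 - (cmod z)\<^sup>2) * norm h"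
      using z2 by (intro mult_mono L2z L2_set_replicate_le_norm L2_set_nonneg) simp
    finally show ?thesis by simp
  qed
  then show "\<exists>N. \<forall>K\<ge>N. norm (sum ?t {..<K}) \<le> norm h / sqrt (1 - (cmod z)\<^sup>2)" by blast
qed

lemma bounded_clinear_fock_eval:
  "bounded_clinear (fock_eval z :: ('n::{finite, linorder}, 'e::chilbert_space) fock \<Rightarrow> 'e)"
proof unfold_locales
  fix f g :: "('n, 'e) fock" and r :: real and c :: complex
  show "fock_eval z (f + g) = fock_eval z f + fock_eval z g"
    unfolding fock_eval_def suminf_add[OF summable_fock_eval summable_fock_eval]
    by (simp add: eslice_def plus_ell2.rep_eq scaleC_add_right)
  have C: "fock_eval z (c *\<^sub>C f) = c *\<^sub>C fock_eval z f" for c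
  proof -
    interpret S: bounded_clinear "\<lambda>x::'e. c *\<^sub>C x" by (rule bounded_clinear_scaleC)
    show ?thesis
      unfolding fock_eval_def S.suminf[OF summable_fock_eval]
      by (simp add: eslice_def scaleC_ell2.rep_eq scaleC_scaleC mult.commute)
  qed
  show "fock_eval z (c *\<^sub>C f) = c *\<^sub>C fock_eval z f" by (rule C)
  show "fock_eval z (r *\<^sub>R f) = r *\<^sub>R fock_eval z f" by (simp only: scaleR_scaleC C)
  show "\<exists>K. \<forall>f :: ('n, 'e) fock. norm (fock_eval z f) \<le> norm f * K"
    by (rule exI[of _ "1 / sqrt (1 - (cmod z)\<^sup>2)"]) (use norm_fock_eval_le in auto)
qed

text \<open>The prefix shifts the coefficient sequence by \<open>m\<close> places.\<close>

lemma fock_eval_ltens: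
  fixes h :: "('n::{finite, linorder}, 'e::chilbert_space) fock"
  shows "fock_eval z (ltens (replicate m first_letter) h) = z ^ m *\<^sub>C fock_eval z h"
proof -
  let ?h = "ltens (replicate m first_letter) h"
  have lt: "eslice (replicate k first_letter) ?h
      = (if m \<le> k then eslice (replicate (k - m) first_letter) h else 0)" for k
    by (auto simp: eslice_def ltens.rep_eq min_def dest: arg_cong[of _ _ length])
  interpret S: bounded_clinear "\<lambda>x::'e. z ^ m *\<^sub>C x" by (rule bounded_clinear_scaleC)
  \<comment> \<open>The first \<open>m\<close> terms vanish: a word shorter than \<open>m\<close>
    cannot begin with the prefix.\<close>
  have "fock_eval z ?h = (\<Sum>k. z ^ (k + m) *\<^sub>C eslice (replicate (k + m) first_letter) ?h)"
    unfolding fock_eval_def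
    using suminf_split_initial_segment[OF summable_fock_eval[where a = first_letter and h = ?h], of m]
    by (simp add: lt)
  also have "\<dots> = (\<Sum>k. z ^ m *\<^sub>C z ^ k *\<^sub>C eslice (replicate k first_letter) h)"
    by (simp add: lt scaleC_scaleC power_add mult.commute)
  also have "\<dots> = z ^ m *\<^sub>C fock_eval z h"
    unfolding fock_eval_def S.suminf[OF summable_fock_eval] ..
  finally show ?thesis .
qed

end

text \<open>Turns domination at points of the disc into a bound on coefficients. By the support
  condition, the norm of \<open>h\<close> is the l2 norm of its coefficients along powers of the
  first letter.\<close>

lemma norm_le_of_fock_eval_le:
  fixes h :: "('n::{finite, linorder}, 'e::chilbert_space) fock" and y :: "nat \<Rightarrow> 'e"
  assumes supp: "\<And>\<mu>. \<mu> \<notin> range (\<lambda>k. replicate k first_letter) \<Longrightarrow> ell2_nth h \<mu> = 0"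
    and M: "0 \<le> M"
    and le: "\<And>z. cmod z < 1 \<Longrightarrow> norm (fock_eval z h) \<le> M * norm (\<Sum>m<N. z ^ m *\<^sub>C y m)"
  shows "norm h \<le> M * L2_set (\<lambda>m. norm (y m)) {..<N}"
proof -
  define c where "c k = eslice (replicate k first_letter) h" for k
  let ?A = "L2_set (\<lambda>m. norm (y m)) {..<N}"
  have trunc: "L2_set (\<lambda>k. r ^ k * norm (c k)) {..<K} \<le> M * ?A + r ^ K * (norm h / (1 - r))"
    if r: "0 \<le> r" "r < 1" and K: "K \<ge> N" "K > 0" for r K
  proof -
    \<comment> \<open>These are \<open>K\<close> equally spaced points on the circle of radius
      \<open>r\<close>; \<open>r < 1\<close> keeps them where \<open>le\<close> applies and makes
      the tail decay as \<open>K\<close> grows.\<close>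
    define z where "z j = complex_of_real r * cis (2 * pi * real j / real K)" for j
    have cz: "cmod (z j) = r" for j using r by (simp add: z_def norm_mult)
    have parseval: "L2_set (\<lambda>j. norm (\<Sum>k<K. z j ^ k *\<^sub>C x k)) {..<K}
        = sqrt (real K) * L2_set (\<lambda>k. r ^ k * norm (x k)) {..<K}" for x :: "nat \<Rightarrow> 'e"
      using parseval_roots_unity[where K = K and x = "\<lambda>k. complex_of_real (r ^ k) *\<^sub>C x k"] r
      by (simp add: L2_set_def real_sqrt_mult[symmetric] z_def scaleC_scaleC norm_scaleC
          norm_power power_mult_distrib mult.commute)
    \<comment> \<open>Padding with zeros gives both polynomials \<open>K\<close> coefficients, so
      that \<open>parseval\<close> applies to each.\<close>
    define y' where "y' m = (if m < N then y m else 0)" for m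
    have y': "(\<Sum>m<K. z ^ m *\<^sub>C y' m) = (\<Sum>m<N. z ^ m *\<^sub>C y m)" for z
      by (rule sum.mono_neutral_cong_right) (use K in \<open>auto simp: y'_def\<close>)
    \<comment> \<open>This bounds the truncation error at every \<open>z j\<close>. A constant has
      L2 norm \<open>sqrt (real K) * e\<close> over the \<open>K\<close> points, the same factor as
      in \<open>parseval\<close>, so dividing it out leaves just \<open>e\<close>.\<close>
    define e where "e = r ^ K * (norm h / (1 - r))"
    have e: "0 \<le> e" using r by (simp add: e_def)
    have "L2_set (\<lambda>k. r ^ k * norm (y' k)) {..<K} \<le> L2_set (\<lambda>k. norm (y' k)) {..<K}"
      by (rule L2_set_mono) (use r in \<open>auto intro!: mult_left_le_one_le power_le_one\<close>)
    also have "\<dots> = ?A"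
      unfolding L2_set_def
      by (intro arg_cong[where f = sqrt] sum.mono_neutral_cong_right) (use K in \<open>auto simp: y'_def\<close>)
    finally have A: "L2_set (\<lambda>k. r ^ k * norm (y' k)) {..<K} \<le> ?A" .
    have "sqrt (real K) * L2_set (\<lambda>k. r ^ k * norm (c k)) {..<K}
        = L2_set (\<lambda>j. norm (\<Sum>k<K. z j ^ k *\<^sub>C c k)) {..<K}"
      by (rule parseval[symmetric])
    also have "\<dots> \<le> L2_set (\<lambda>j. M * norm (\<Sum>m<K. z j ^ m *\<^sub>C y' m) + e) {..<K}"
    proof (rule L2_set_mono)
      fix j
      have "norm (\<Sum>k<K. z j ^ k *\<^sub>C c k)
          \<le> norm (fock_eval (z j) h) + norm (fock_eval (z j) h - (\<Sum>k<K. z j ^ k *\<^sub>C c k))"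
        using norm_triangle_sub[of "\<Sum>k<K. z j ^ k *\<^sub>C c k" "fock_eval (z j) h"]
        by (simp add: norm_minus_commute)
      also have "\<dots> \<le> M * norm (\<Sum>m<K. z j ^ m *\<^sub>C y' m) + e"
        using le[of "z j"] norm_fock_eval_tail[of "z j" h K] r
        unfolding c_def e_def y' cz by (intro add_mono) auto
      finally show "norm (\<Sum>k<K. z j ^ k *\<^sub>C c k) \<le> M * norm (\<Sum>m<K. z j ^ m *\<^sub>C y' m) + e" .
    qed simp
    also have "\<dots> \<le> L2_set (\<lambda>j. M * norm (\<Sum>m<K. z j ^ m *\<^sub>C y' m)) {..<K} + L2_set (\<lambda>j. e) {..<K}"
      by (rule L2_set_triangle_ineq)
    also have "\<dots> = sqrt (real K) * (M * L2_set (\<lambda>k. r ^ k * norm (y' k)) {..<K} + e)"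
      using e by (simp only: L2_set_right_distrib[OF M, symmetric] parseval)
        (simp add: L2_set_def real_sqrt_mult distrib_left mult.left_commute)
    also have "\<dots> \<le> sqrt (real K) * (M * ?A + e)"
      by (intro mult_left_mono add_right_mono A M) simp
    finally show ?thesis using K by (simp add: e_def)
  qed
  \<comment> \<open>With the number \<open>J\<close> of coefficients fixed, first \<open>K\<close>
    tends to infinity at fixed \<open>r\<close>, which removes the error; then \<open>r\<close>
    tends to 1 in a finite sum, which is continuous in \<open>r\<close>.\<close>
  have bound: "L2_set (\<lambda>k. norm (c k)) {..<J} \<le> M * ?A" for J
  proof -
    have disc: "L2_set (\<lambda>k. r ^ k * norm (c k)) {..<J} \<le> M * ?A" if r: "0 \<le> r" "r < 1" for r
    proof (rule LIMSEQ_le_const)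
      have "(\<lambda>K. r ^ K) \<longlonglongrightarrow> 0" using r by (intro LIMSEQ_power_zero) simp
      from tendsto_add[OF tendsto_const tendsto_mult_left_zero[OF this]]
      show "(\<lambda>K. M * ?A + r ^ K * (norm h / (1 - r))) \<longlonglongrightarrow> M * ?A" by (metis add.right_neutral)
      \<comment> \<open>\<open>Suc N\<close> ensures both \<open>K \<ge> N\<close> and
        \<open>K > 0\<close>, as \<open>trunc\<close> requires; \<open>J\<close> ensures that the
        first \<open>J\<close> coefficients are among those counted.\<close>
      have "L2_set (\<lambda>k. r ^ k * norm (c k)) {..<J} \<le> M * ?A + r ^ K * (norm h / (1 - r))"
        if "K \<ge> max (Suc N) J" for K
      proof -
        have "L2_set (\<lambda>k. r ^ k * norm (c k)) {..<J} \<le> L2_set (\<lambda>k. r ^ k * norm (c k)) {..<K}"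
          unfolding L2_set_def using that by (intro real_sqrt_le_mono sum_mono2) auto
        also have "\<dots> \<le> M * ?A + r ^ K * (norm h / (1 - r))" using that r by (intro trunc) auto
        finally show ?thesis .
      qed
      then show "\<exists>N. \<forall>K\<ge>N. L2_set (\<lambda>k. r ^ k * norm (c k)) {..<J}
          \<le> M * ?A + r ^ K * (norm h / (1 - r))" by blast
    qed
    show ?thesis
    proof (rule tendsto_upperbound)
      show "((\<lambda>r. L2_set (\<lambda>k. r ^ k * norm (c k)) {..<J}) \<longlongrightarrow> L2_set (\<lambda>k. norm (c k)) {..<J})
          (at_left 1)"
        unfolding L2_set_def by (auto intro!: tendsto_eq_intros)
      show "\<forall>\<^sub>F r in at_left 1. L2_set (\<lambda>k. r ^ k * norm (c k)) {..<J} \<le> M * ?A"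
        using eventually_at_left_real[of 0 1] by (auto elim!: eventually_mono intro!: disc)
    qed simp
  qed
  show ?thesis
  proof (rule norm_ell2_le)
    fix F :: "'n list set" assume F: "finite F"
    \<comment> \<open>\<open>J\<close> exceeds every length in \<open>F\<close>, so
      \<open>?R\<close> contains all powers of the first letter in \<open>F\<close>; inserting 0
      covers empty \<open>F\<close>.\<close>
    define J where "J = Suc (Max (insert 0 (length ` F)))"
    have J: "length \<mu> < J" if "\<mu> \<in> F" for \<mu>
      unfolding J_def less_Suc_eq_le using F that by (intro Max_ge) auto
    let ?R = "(\<lambda>k. replicate k first_letter) ` {..<J} :: 'n list set"
    have "(\<Sum>\<mu>\<in>F. (norm (ell2_nth h \<mu>))\<^sup>2) = (\<Sum>\<mu>\<in>F \<inter> ?R. (norm (ell2_nth h \<mu>))\<^sup>2)"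
    proof (rule sum.mono_neutral_right[OF F], simp, rule ballI)
      fix \<mu> assume \<mu>: "\<mu> \<in> F - F \<inter> ?R"
      have "\<mu> \<notin> range (\<lambda>k. replicate k first_letter)"
      proof
        assume "\<mu> \<in> range (\<lambda>k. replicate k first_letter)"
        then obtain k where "\<mu> = replicate k first_letter" by auto
        with \<mu> J[of \<mu>] show False by auto
      qed
      then show "(norm (ell2_nth h \<mu>))\<^sup>2 = 0" by (simp add: supp)
    qed
    also have "\<dots> \<le> (\<Sum>\<mu>\<in>?R. (norm (ell2_nth h \<mu>))\<^sup>2)" by (rule sum_mono2) auto
    also have "\<dots> = (\<Sum>k<J. (norm (c k))\<^sup>2)"
      by (subst sum.reindex) (auto simp: c_def eslice_def intro: inj_on_inverseI[where g = length])
    finally show "L2_set (\<lambda>\<mu>. norm (ell2_nth h \<mu>)) F \<le> M * ?A"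
      using bound[of J] unfolding L2_set_def by (meson order_trans real_sqrt_le_mono)
  qed
qed


section \<open>The odometer on words\<close>

lemma first_letter_le: "first_letter \<le> (a :: 'n::{finite, linorder})"
  by (simp add: first_letter_def)

lemma less_next_letter:
  assumes "a \<noteq> last_letter"
  shows "a < next_letter a"
proof -
  have "a \<le> last_letter" by (simp add: last_letter_def)
  with assms have "last_letter \<in> {b. a < b}" by simp
  then have "{b. a < b} \<noteq> {}" by blast
  from Min_in[OF _ this] show ?thesis unfolding next_letter_def by simp
qed

lemma next_letter_le: "a < b \<Longrightarrow> next_letter a \<le> b"
  by (simp add: next_letter_def)

text \<open>If \<open>a < b\<close>, then
  \<open>next_letter a \<le> b < next_letter b\<close>.\<close>

lemma next_letter_inject:
  assumes "a \<noteq> last_letter" "b \<noteq> last_letter" "next_letter a = next_letter b"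
  shows "a = b"
  using assms less_next_letter next_letter_le by (metis leD linorder_neqE)

lemma next_letter_neq_first: "a \<noteq> last_letter \<Longrightarrow> next_letter a \<noteq> first_letter"
  using less_next_letter[of a] first_letter_le[of a] by auto

text \<open>Addition of one with carry, the leftmost digit being the least significant; a carry past
  the end is dropped. The recursion replaces the least index in \<open>odometer_map\<close>, which
  makes induction on words available.\<close>

fun succ_word :: "'n::{finite, linorder} list \<Rightarrow> 'n list" where
  "succ_word [] = []"
| "succ_word (a # \<mu>) = (if a = last_letter then first_letter # succ_word \<mu> else next_letter a # \<mu>)"

text \<open>The head of the image reveals whether a carry took place: it is the first letter exactly
  when the original head was the last letter.\<close>

lemma inj_succ_word: "inj succ_word"
proof -
  have "succ_word \<mu> = succ_word \<nu> \<Longrightarrow> \<mu> = \<nu>" for \<mu> \<nu> :: "'a list"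
  proof (induction \<mu> arbitrary: \<nu>)
    case Nil
    then show ?case by (cases \<nu>) (auto split: if_splits)
  next
    case (Cons a \<mu>)
    then show ?case
      by (cases \<nu>) (auto split: if_splits dest: next_letter_inject next_letter_neq_first
          next_letter_neq_first[THEN not_sym])
  qed
  then show ?thesis by (auto simp: inj_def)
qed

text \<open>The digit at which the carry stops becomes a successor, which is never the first letter.
  This keeps such images orthogonal to \<open>M_perp\<close>.\<close>

lemma succ_word_not_all_first:
  assumes "\<exists>a\<in>set \<mu>. a \<noteq> last_letter"
  shows "succ_word \<mu> \<notin> range (\<lambda>k. replicate k first_letter)"
  using assms
proof (induction \<mu>)
  case (Cons a \<mu>)
  have "\<exists>b\<in>set (succ_word (a # \<mu>)). b \<noteq> first_letter"
    using Cons next_letter_neq_first[of a]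
    by (auto simp: image_iff) (metis replicate_length_same)
  then show ?case by auto
qed simp

text \<open>The least index in \<open>odometer_map\<close> is the length of the longest prefix of
  last letters, exactly where the carry of \<open>succ_word\<close> stops.\<close>

lemma odometer_map_etens:
  assumes "odometer_map L W" and \<mu>: "\<exists>a\<in>set \<mu>. a \<noteq> last_letter"
  shows "W (etens \<mu> \<eta>) = etens (succ_word \<mu>) \<eta>"
proof -
  obtain \<alpha> a \<nu> where split: "\<mu> = \<alpha> @ a # \<nu>" "a \<noteq> last_letter" "\<forall>b\<in>set \<alpha>. b = last_letter"
    using split_list_first_prop[of \<mu> "\<lambda>a. a \<noteq> last_letter"] \<mu> by metis
  define k where "k = length \<alpha>"
  have \<alpha>: "\<alpha> = replicate k last_letter"
    using split(3) by (simp add: k_def replicate_length_same)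
  have least: "(LEAST i. i < length \<mu> \<and> \<mu> ! i \<noteq> last_letter) = k"
  proof (rule Least_equality)
    show "k < length \<mu> \<and> \<mu> ! k \<noteq> last_letter" using split by (simp add: k_def)
    show "k \<le> i" if "i < length \<mu> \<and> \<mu> ! i \<noteq> last_letter" for i
      using that by (rule contrapos_pp) (simp add: split(1) \<alpha> nth_append)
  qed
  have "let k = (LEAST i. i < length \<mu> \<and> \<mu> ! i \<noteq> last_letter)
    in W (etens \<mu> \<eta>) = etens (replicate k first_letter @ [next_letter (\<mu> ! k)] @ drop (Suc k) \<mu>) \<eta>"
    using assms unfolding odometer_map_def by blast
  then have "W (etens \<mu> \<eta>)
      = etens (replicate k first_letter @ [next_letter (\<mu> ! k)] @ drop (Suc k) \<mu>) \<eta>"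
    by (simp only: Let_def least)
  also have "replicate k first_letter @ [next_letter (\<mu> ! k)] @ drop (Suc k) \<mu> = succ_word \<mu>"
  proof -
    have "succ_word (replicate k last_letter @ a # \<nu>) = replicate k first_letter @ next_letter a # \<nu>"
      by (induction k) (use split(2) in auto)
    then show ?thesis by (simp add: split(1) \<alpha> nth_append)
  qed
  finally show ?thesis .
qed

text \<open>The coordinate at \<open>\<mu>\<close> is continuous and linear and vanishes on the
  generators, hence on their closed span.\<close>

lemma M_perp_nth:
  fixes h :: "('n::{finite, linorder}, 'e::complex_inner) fock"
  assumes "h \<in> M_perp" "\<mu> \<notin> range (\<lambda>k. replicate k first_letter)"
  shows "ell2_nth h \<mu> = 0"
proof -
  let ?S = "{h :: ('n, 'e) fock. ell2_nth h \<mu> = 0}"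
  interpret bounded_clinear "\<lambda>h::('n, 'e) fock. ell2_nth h \<mu>" by (rule bounded_clinear_ell2_nth)
  have "complex_vector.subspace ?S"
    by (rule complex_vector.subspaceI) (auto simp: zero_ell2.rep_eq plus_ell2.rep_eq scaleC_ell2.rep_eq)
  moreover have "{etens (replicate m first_letter) \<xi> | m \<xi>. True} \<subseteq> ?S"
    using assms(2) by (auto simp: etens.rep_eq)
  ultimately have "complex_vector.span {etens (replicate m first_letter) \<xi> | m \<xi>. True} \<subseteq> ?S"
    by (intro complex_vector.span_minimal)
  moreover have "closed ?S"
    by (rule closed_Collect_eq[OF linear_continuous_on[OF bounded_linear_axioms] continuous_on_const])
  ultimately have "M_perp \<subseteq> ?S"
    unfolding M_perp_def by (rule closure_minimal)
  with assms(1) show ?thesis by auto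
qed


section \<open>The norm of the odometer map\<close>

context
  fixes L :: "'e::chilbert_space \<Rightarrow> ('n::{finite, linorder}, 'e) fock"
    and W :: "('n, 'e) fock \<Rightarrow> ('n, 'e) fock"
  assumes W: "odometer_map L W"
begin

lemma odometer_bounded_clinear: "bounded_clinear W"
  using W by (simp add: odometer_map_def)

interpretation W: bounded_clinear W
  by (rule odometer_bounded_clinear)

text \<open>The clauses for the empty word and for positive powers merge, since tensoring by the
  empty word is the identity.\<close>

lemma odometer_map_last:
  "W (etens (replicate m last_letter) \<eta>) = ltens (replicate m first_letter) (L \<eta>)"
proof (cases "m = 0")
  case True
  have "ltens [] f = f" for f :: "('n, 'e) fock" by (simp add: ell2_eq_iff ltens.rep_eq)
  with True show ?thesis using W by (simp add: odometer_map_def)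
next
  case False
  then show ?thesis using W by (simp add: odometer_map_def)
qed

text \<open>Identifying the \<open>m\<close>-th power of the last letter with \<open>z ^ m\<close>,
  the operator becomes multiplication by the symbol: each power contributes a shift of
  \<open>L (y m)\<close>, and evaluation turns the shift into a factor \<open>z ^ m\<close>.\<close>

lemma fock_eval_odometer:
  assumes z: "cmod z < 1" and L: "bounded_clinear L"
  shows "fock_eval z (W (\<Sum>m<N. etens (replicate m last_letter) (y m)))
    = analytic_symbol L z (\<Sum>m<N. z ^ m *\<^sub>C y m)"
proof -
  interpret E: bounded_clinear "fock_eval z :: ('n, 'e) fock \<Rightarrow> 'e"
    by (rule bounded_clinear_fock_eval[OF z])
  interpret T: bounded_clinear "analytic_symbol L z"
    by (rule bounded_clinear_analytic_symbol[OF L z])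
  show ?thesis
    by (simp add: W.sum E.sum T.sum T.scaleC odometer_map_last fock_eval_ltens[OF z]
        analytic_symbol_eq_fock_eval[symmetric])
qed

text \<open>
  Testing on the truncated Szego kernels \<open>\<Sum>m<N. e\<^sub>n\<^sup>m \<otimes> cnj z ^ m \<eta>\<close>: evaluation at \<open>z\<close> turns the
  image into a multiple of \<open>\<Theta>(z) \<eta>\<close>.
\<close>

lemma norm_analytic_symbol_le:
  assumes L: "bounded_clinear L" and z: "cmod z < 1"
  shows "norm (analytic_symbol L z \<eta>) \<le> onorm W * norm \<eta>"
proof -
  interpret T: bounded_clinear "analytic_symbol L z"
    by (rule bounded_clinear_analytic_symbol[OF L z])
  \<comment> \<open>\<open>S N\<close> is the squared norm of the scalar truncated kernel and
    \<open>s\<close>, its limit, that of the full Szego kernel at \<open>z\<close>.\<close>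
  define S where "S N = (\<Sum>m<N. ((cmod z)\<^sup>2) ^ m)" for N
  define s where "s = 1 / (1 - (cmod z)\<^sup>2)"
  have z2: "(cmod z)\<^sup>2 < 1" using z by (simp add: power_less_one_iff)
  have s: "s > 0" using z2 by (simp add: s_def)
  have lim: "S \<longlonglongrightarrow> s"
    unfolding S_def s_def using z2 geometric_sums[of "(cmod z)\<^sup>2"] by (simp add: sums_def)
  have le: "S N * norm (analytic_symbol L z \<eta>) \<le> onorm W * norm \<eta> * (sqrt (S N) * sqrt s)" for N
  proof -
    define g :: "('n, 'e) fock"
      where "g = (\<Sum>m<N. etens (replicate m last_letter) (cnj z ^ m *\<^sub>C \<eta>))"
    have S0: "S N \<ge> 0" by (simp add: S_def sum_nonneg)
    have "(norm g)\<^sup>2 = S N * (norm \<eta>)\<^sup>2"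
      unfolding g_def S_def
      by (subst norm_sum_etens)
        (auto intro: inj_on_inverseI[where g = length] simp: norm_scaleC norm_power
          power_mult_distrib sum_distrib_left sum_distrib_right power_mult[symmetric] mult.commute)
    then have g: "norm g = sqrt (S N) * norm \<eta>"
      by (metis norm_ge_zero real_sqrt_mult real_sqrt_unique)
    have "(\<Sum>m<N. z ^ m *\<^sub>C cnj z ^ m *\<^sub>C \<eta>) = complex_of_real (S N) *\<^sub>C \<eta>"
      unfolding S_def of_real_sum complex_vector.scale_sum_left
      by (simp add: scaleC_scaleC power_mult_distrib[symmetric] complex_norm_square[symmetric]
          flip: of_real_power)
    then have "fock_eval z (W g) = complex_of_real (S N) *\<^sub>C analytic_symbol L z \<eta>"
      unfolding g_def fock_eval_odometer[OF z L] by (simp add: T.scaleC)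
    then have "S N * norm (analytic_symbol L z \<eta>) = norm (fock_eval z (W g))"
      using S0 by (simp add: norm_scaleC)
    also have "\<dots> \<le> norm (W g) / sqrt (1 - (cmod z)\<^sup>2)" by (rule norm_fock_eval_le[OF z])
    also have "\<dots> \<le> onorm W * norm g / sqrt (1 - (cmod z)\<^sup>2)"
      using z2 by (intro divide_right_mono onorm W.bounded_linear_axioms) simp
    also have "\<dots> = onorm W * norm \<eta> * (sqrt (S N) * sqrt s)"
      by (simp add: g s_def real_sqrt_divide)
    finally show ?thesis .
  qed
  \<comment> \<open>In the limit the factor \<open>sqrt (S N)\<close> from the norm of
    \<open>g\<close> and the factor \<open>sqrt s\<close> from the norm of evaluation combine to
    \<open>s\<close>, which cancels.\<close>
  have "s * norm (analytic_symbol L z \<eta>) \<le> onorm W * norm \<eta> * (sqrt s * sqrt s)"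
    by (rule LIMSEQ_le[OF tendsto_mult_right[OF lim]
          tendsto_mult_left[OF tendsto_mult_right[OF tendsto_real_sqrt[OF lim]]]]) (use le in blast)
  then show ?thesis using s by (simp add: mult.commute)
qed

text \<open>Multiplication by the symbol is bounded pointwise by \<open>M\<close>, and
  \<open>norm_le_of_fock_eval_le\<close> transfers this to norms; its support condition comes from
  \<open>range L \<subseteq> M_perp\<close>. The support is also a conclusion because it yields
  orthogonality to the rest of the range.\<close>

lemma norm_odometer_last_le:
  assumes L: "bounded_clinear L" and ran: "range L \<subseteq> M_perp" and "0 \<le> M"
    and le: "\<And>z \<eta>. cmod z < 1 \<Longrightarrow> norm (analytic_symbol L z \<eta>) \<le> M * norm \<eta>"
  defines "g \<equiv> \<lambda>N y. \<Sum>m<N. etens (replicate m last_letter) (y m)"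
  shows "norm (W (g N y)) \<le> M * norm (g N y)"
    and "\<mu> \<notin> range (\<lambda>k. replicate k first_letter) \<Longrightarrow> ell2_nth (W (g N y)) \<mu> = 0"
proof -
  have supp: "ell2_nth (W (g N y)) \<mu> = 0" if "\<mu> \<notin> range (\<lambda>k. replicate k first_letter)" for \<mu>
  proof -
    have "ell2_nth (ltens (replicate m first_letter) (L \<eta>)) \<mu> = 0" for m \<eta>
    proof (cases "take m \<mu> = replicate m first_letter")
      case True
      have "drop m \<mu> \<notin> range (\<lambda>k. replicate k first_letter)"
      proof
        assume "drop m \<mu> \<in> range (\<lambda>k. replicate k first_letter)"
        then obtain k where "drop m \<mu> = replicate k first_letter" by auto
        with True have "\<mu> = replicate (m + k) first_letter"
          by (metis append_take_drop_id replicate_add)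
        with that show False by auto
      qed
      then show ?thesis
        using M_perp_nth[of "L \<eta>" "drop m \<mu>"] ran by (auto simp: ltens.rep_eq)
    qed (simp add: ltens.rep_eq)
    then show ?thesis by (simp add: g_def W.sum odometer_map_last ell2_nth_sum)
  qed
  then show "ell2_nth (W (g N y)) \<mu> = 0" if "\<mu> \<notin> range (\<lambda>k. replicate k first_letter)" using that .
  have "norm (W (g N y)) \<le> M * L2_set (\<lambda>m. norm (y m)) {..<N}"
    by (rule norm_le_of_fock_eval_le[OF supp \<open>0 \<le> M\<close>])
      (auto simp: g_def fock_eval_odometer[OF _ L] intro: le)
  also have "L2_set (\<lambda>m. norm (y m)) {..<N} = norm (g N y)"
    unfolding L2_set_def g_def
    by (rule real_sqrt_unique, rule norm_sum_etens) (auto intro: inj_on_inverseI[where g = length])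
  finally show "norm (W (g N y)) \<le> M * norm (g N y)" .
qed

lemma norm_odometer_le:
  assumes L: "bounded_clinear L" and ran: "range L \<subseteq> M_perp" and C: "1 \<le> C"
    and le: "\<And>z \<eta>. cmod z < 1 \<Longrightarrow> norm (analytic_symbol L z \<eta>) \<le> C * norm \<eta>"
  shows "norm (W f) \<le> C * norm f"
proof (rule bounded_linear_fock_le[OF W.bounded_linear_axioms])
  fix f :: "('n, 'e) fock" assume fin: "finite {\<mu>. ell2_nth f \<mu> \<noteq> 0}"
  let ?S = "{\<mu>. ell2_nth f \<mu> \<noteq> 0}"
  \<comment> \<open>\<open>N\<close> exceeds the length of every word in the support, so
    \<open>A\<close> contains each power of the last letter occurring there. Taking all powers below
    \<open>N\<close>, even where \<open>f\<close> vanishes, gives \<open>f1\<close> the form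
    required by \<open>norm_odometer_last_le\<close>.\<close>
  define N where "N = Suc (Max (insert 0 (length ` ?S)))"
  have N: "length \<mu> < N" if "\<mu> \<in> ?S" for \<mu>
    unfolding N_def less_Suc_eq_le using fin that by (intro Max_ge) auto
  define A :: "'n list set" where "A = (\<lambda>m. replicate m last_letter) ` {..<N}"
  define B where "B = {\<mu> \<in> ?S. \<exists>a\<in>set \<mu>. a \<noteq> last_letter}"
  define f1 :: "('n, 'e) fock"
    where "f1 = (\<Sum>m<N. etens (replicate m last_letter) (ell2_nth f (replicate m last_letter)))"
  define f2 where "f2 = (\<Sum>\<mu>\<in>B. etens \<mu> (ell2_nth f \<mu>))"
  have finB: "finite B" using fin by (simp add: B_def)
  have disj: "A \<inter> B = {}" by (auto simp: A_def B_def)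
  have "?S \<subseteq> A \<union> B"
  proof
    fix \<mu> assume \<mu>: "\<mu> \<in> ?S"
    show "\<mu> \<in> A \<union> B"
    proof (cases "\<exists>a\<in>set \<mu>. a \<noteq> last_letter")
      case False
      then have "\<mu> = replicate (length \<mu>) last_letter" by (metis replicate_length_same)
      with N[OF \<mu>] show ?thesis unfolding A_def by blast
    qed (use \<mu> in \<open>simp add: B_def\<close>)
  qed
  then have "f = (\<Sum>\<mu>\<in>A \<union> B. etens \<mu> (ell2_nth f \<mu>))"
    by (intro finite_support_expansion) (simp_all add: A_def finB)
  also have "\<dots> = (\<Sum>\<mu>\<in>A. etens \<mu> (ell2_nth f \<mu>)) + f2"
    unfolding f2_def by (rule sum.union_disjoint) (simp_all add: A_def[symmetric] finB disj, simp add: A_def)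
  also have "(\<Sum>\<mu>\<in>A. etens \<mu> (ell2_nth f \<mu>)) = f1"
    unfolding A_def f1_def by (subst sum.reindex) (auto intro: inj_on_inverseI[where g = length])
  finally have f: "f = f1 + f2" .
  have "cinner f1 f2 = 0"
    unfolding f1_def f2_def cinner_sum_left cinner_sum_right cinner_etens
    by (intro sum.neutral ballI) (auto simp: B_def)
  then have nf: "(norm f)\<^sup>2 = (norm f1)\<^sup>2 + (norm f2)\<^sup>2"
    unfolding f by (rule norm_add_sq_orthogonal)
  have Wf2: "W f2 = (\<Sum>\<mu>\<in>B. etens (succ_word \<mu>) (ell2_nth f \<mu>))"
    unfolding f2_def W.sum by (intro sum.cong refl odometer_map_etens[OF W]) (simp add: B_def)
  have "cinner (W f1) (W f2) = 0"
  \<comment> \<open>The two images have disjoint supports: powers of the first letter for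
    \<open>f1\<close>, all other words for \<open>f2\<close>.\<close>
  proof (rule cinner_ell2_disjoint)
    fix \<mu>
    show "ell2_nth (W f1) \<mu> = 0 \<or> ell2_nth (W f2) \<mu> = 0"
    proof (cases "\<mu> \<in> range (\<lambda>k. replicate k first_letter)")
      case True
      have "\<mu> \<noteq> succ_word \<nu>" if "\<nu> \<in> B" for \<nu>
        using succ_word_not_all_first[of \<nu>] that True unfolding B_def by blast
      then show ?thesis by (simp add: Wf2 ell2_nth_sum etens.rep_eq)
    next
      case False
      then show ?thesis
        unfolding f1_def using C norm_odometer_last_le(2)[OF L ran _ le] by auto
    qed
  qed
  then have "(norm (W f))\<^sup>2 = (norm (W f1))\<^sup>2 + (norm (W f2))\<^sup>2"
    unfolding f W.add by (rule norm_add_sq_orthogonal)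
  also have "norm (W f2) = norm f2"
    unfolding Wf2 unfolding f2_def
    by (rule power2_eq_imp_eq)
      (simp_all add: norm_sum_etens[OF finB] norm_sum_etens[OF finB, of "\<lambda>\<mu>. \<mu>"]
        inj_on_subset[OF inj_succ_word])
  also have "(norm (W f1))\<^sup>2 + (norm f2)\<^sup>2 \<le> (C * norm f1)\<^sup>2 + (C * norm f2)\<^sup>2"
  proof (intro add_mono power_mono)
    show "norm (W f1) \<le> C * norm f1"
      unfolding f1_def using C by (intro norm_odometer_last_le(1)[OF L ran _ le]) auto
    \<comment> \<open>The isometric part is where \<open>1 \<le> C\<close> is needed.\<close>
    show "norm f2 \<le> C * norm f2" using C mult_right_mono[of 1 C "norm f2"] by simp
  qed simp_all
  also have "\<dots> = (C * norm f)\<^sup>2" by (simp add: power_mult_distrib nf distrib_left)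
  finally show "norm (W f) \<le> C * norm f"
    by (rule power2_le_imp_le) (use C in simp)
qed

text \<open>With at least two letters there is a one-letter word other than the last letter, and the
  operator preserves the norm of the corresponding tensors.\<close>

lemma onorm_odometer_ge_1:
  assumes "CARD('n) \<noteq> 1" and "\<exists>\<eta>::'e. \<eta> \<noteq> 0"
  shows "1 \<le> onorm W"
proof -
  obtain \<eta> :: 'e where \<eta>: "\<eta> \<noteq> 0" using assms(2) by blast
  have "\<exists>a::'n. a \<noteq> last_letter"
  proof (rule ccontr)
    assume "\<nexists>a::'n. a \<noteq> last_letter"
    then have "UNIV = {last_letter :: 'n}" by auto
    then have "CARD('n) = card {last_letter :: 'n}" by (rule arg_cong)
    with assms(1) show False by simp
  qed
  then obtain a :: 'n where "a \<noteq> last_letter" by blast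
  then have "norm (W (etens [a] \<eta>)) = norm \<eta>"
    by (subst odometer_map_etens[OF W]) (simp_all add: norm_etens)
  with onorm[OF W.bounded_linear_axioms, of "etens [a] \<eta>"] \<eta> show ?thesis
    by (simp add: norm_etens)
qed

end

text \<open>For a single letter every word is a power of it, so there is no isometric part and the
  norm is that of the symbol, which can be below 1; for zero \<open>'e\<close> the operator norm is
  0. The conditions on \<open>CARD('n)\<close> and on a nonzero vector address these two
  cases.\<close>

theorem proposition4p6:
  fixes L :: "'e::chilbert_space \<Rightarrow> ('n::{finite, linorder}, 'e) fock"
    and W :: "('n, 'e) fock \<Rightarrow> ('n, 'e) fock"
  assumes "separable_space (euclidean :: 'e topology)"
    and "\<exists>\<eta> :: 'e. \<eta> \<noteq> 0"
    and "bounded_clinear L"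
    and "odometer_map L W"
    and "range L \<subseteq> M_perp"
    and "CARD('n) = 1 \<Longrightarrow> 1 \<le> Hinf_norm (analytic_symbol L)"
  shows "ereal (onorm W) = max 1 (Hinf_norm (analytic_symbol L))"
proof (rule antisym)
  let ?H = "Hinf_norm (analytic_symbol L)"
  interpret W: bounded_clinear W by (rule odometer_bounded_clinear[OF assms(4)])
  have H_le: "?H \<le> ereal (onorm W)"
    unfolding Hinf_norm_def
  proof (rule SUP_least)
    fix z :: complex assume "z \<in> ball 0 1"
    then have "norm (analytic_symbol L z \<eta>) \<le> onorm W * norm \<eta>" for \<eta>
      by (intro norm_analytic_symbol_le[OF assms(4,3)]) simp
    then show "ereal (onorm (analytic_symbol L z)) \<le> ereal (onorm W)"
      unfolding ereal_less_eq by (intro onorm_bound onorm_pos_le W.bounded_linear_axioms)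
  qed
  show "max 1 ?H \<le> ereal (onorm W)"
  \<comment> \<open>The lower bound 1 comes from the assumed bound on the symbol for one letter, and
    from the isometric part otherwise.\<close>
  proof (cases "CARD('n) = 1")
    case True
    with assms(6) H_le show ?thesis by (auto intro: order_trans)
  next
    case False
    with onorm_odometer_ge_1[OF assms(4) _ assms(2)] H_le show ?thesis
      by (simp add: one_ereal_def)
  qed
  moreover have "1 \<le> max 1 ?H" by simp
  moreover have "\<exists>C. x = ereal C \<and> 1 \<le> C" if "x \<le> ereal (onorm W)" "1 \<le> x" for x
    using that by (cases x) auto
  \<comment> \<open>The lower bound just proved makes the maximum finite, so it is a real number and
    can serve as the constant in \<open>norm_odometer_le\<close>.\<close>
  ultimately obtain C where C: "max 1 ?H = ereal C" "1 \<le> C" by blast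
  have "norm (analytic_symbol L z \<eta>) \<le> C * norm \<eta>" if z: "cmod z < 1" for z \<eta>
  proof -
    interpret T: bounded_clinear "analytic_symbol L z"
      by (rule bounded_clinear_analytic_symbol[OF assms(3) z])
    have "ereal (onorm (analytic_symbol L z)) \<le> ?H"
      unfolding Hinf_norm_def using z by (intro SUP_upper) simp
    also have "\<dots> \<le> ereal C" unfolding C(1)[symmetric] by simp
    finally have "onorm (analytic_symbol L z) \<le> C" by simp
    then show ?thesis
      by (intro order_trans[OF onorm[OF T.bounded_linear_axioms]] mult_right_mono) auto
  qed
  then have "onorm W \<le> C"
    using C(2) by (intro onorm_bound norm_odometer_le[OF assms(4,3,5) C(2)]) auto
  then show "ereal (onorm W) \<le> max 1 ?H" by (simp add: C(1))
qed

end
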